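(* Let $g \geq 3$ be an odd integer. Suppose $G$ is an $n$-vertex graph with $m$ edges and girth $g+1$, and let $t$ be the number of $(g+1)$-cycles in $G$ (cycles counted as subgraphs). Then \[ P(G,q) - P_{DP}(G,q) = t\, q^{n-g} + O(q^{n-g-1}) \] as $q \to \infty$ (over $q\in\mathbb{N}$).
   Context: All graphs are nonempty, finite and simple, and $\mathbb{N}=\{1,2,3,\dots\}$. The girth of a graph is the length of its shortest cycle. $P(G,q)$ is the chromatic polynomial of $G$, i.e. the number of proper colorings of $G$ with colors from $\{1,\dots,q\}$. For a graph $H$ and $S,U\subseteq V(H)$, $E_H(S,U)$ is the set of edges of $H$ with one endpoint in $S$ and the other in $U$. A cover of a graph $G$ is a pair $\mathcal{H}=(L,H)$ where $H$ is a graph and $L$ assigns to each $v\in V(G)$ a set $L(v)\subseteq V(H)$ such that: the sets $L(v)$, $v\in V(G)$, are pairwise disjoint, each $L(v)$ is an independent set in $H$, and $V(H)=\bigcup_{v\in V(G)}L(v)$; and for all distinct $u,v\in V(G)$, $E_H(L(u),L(v))$ is a matching (not necessarily perfect, possibly empty), which is empty whenever $uv\notin E(G)$. For $q\in\mathbb{N}$, the cover is $q$-fold if $|L(v)|=q$ for every $v\in V(G)$. A proper $\mathcal{H}$-coloring of $G$ is a set $T\subseteq V(H)$ with $|T\cap L(v)|=1$ for every $v\in V(G)$ that is independent in $H$. $P_{DP}(G,\mathcal{H})$ denotes the number of proper $\mathcal{H}$-colorings of $G$. The DP color function $P_{DP}(G,q)$ is the minimum of $P_{DP}(G,\mathcal{H})$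 over all $q$-fold covers $\mathcal{H}$ of $G$. *)

theory Defs
  imports Complex_Main "HOL-Library.FuncSet" "HOL-Library.Disjoint_Sets"
    "HOL-Library.Extended_Nat" "HOL-Library.Landau_Symbols"
begin

record 'a ugraph =
  verts :: "'a set"
  edges :: "'a set set"

definition simple_graph :: "'a ugraph \<Rightarrow> bool" where
  "simple_graph G \<longleftrightarrow> finite (verts G) \<and> verts G \<noteq> {} \<and>
     (\<forall>e\<in>edges G. e \<subseteq> verts G \<and> card e = 2)"

definition independent_in :: "'a ugraph \<Rightarrow> 'a set \<Rightarrow> bool" where
  "independent_in G S \<longleftrightarrow> S \<subseteq> verts G \<and> (\<forall>x\<in>S. \<forall>y\<in>S. {x, y} \<notin> edges G)"

definition edges_between :: "'a ugraph \<Rightarrow> 'a set \<Rightarrow> 'a set \<Rightarrow> 'a set set" where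
  "edges_between G S U = {e \<in> edges G. \<exists>s\<in>S. \<exists>u\<in>U. e = {s, u}}"

definition matching :: "'a set set \<Rightarrow> bool" where
  "matching M \<longleftrightarrow> pairwise disjnt M"


definition is_cycle :: "nat \<Rightarrow> 'a ugraph \<Rightarrow> bool" where
  "is_cycle k C \<longleftrightarrow> 3 \<le> k \<and> (\<exists>vs. length vs = k \<and> distinct vs \<and> verts C = set vs \<and>
     edges C = {{vs ! i, vs ! (Suc i mod k)} | i. i < k})"

definition subgraph :: "'a ugraph \<Rightarrow> 'a ugraph \<Rightarrow> bool" where
  "subgraph C G \<longleftrightarrow> verts C \<subseteq> verts G \<and> edges C \<subseteq> edges G"

definition cycles :: "'a ugraph \<Rightarrow> nat \<Rightarrow> 'a ugraph set" where
  "cycles G k = {C. is_cycle k C \<and> subgraph C G}"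

text \<open>Since \<open>Inf {} = \<infinity>\<close>, acyclic graphs have infinite girth.\<close>

definition girth :: "'a ugraph \<Rightarrow> enat" where
  "girth G = Inf {enat k | k. cycles G k \<noteq> {}}"


definition proper_colorings :: "'a ugraph \<Rightarrow> nat \<Rightarrow> ('a \<Rightarrow> nat) set" where
  "proper_colorings G q =
     {f \<in> verts G \<rightarrow>\<^sub>E {1..q}. \<forall>u v. {u, v} \<in> edges G \<longrightarrow> f u \<noteq> f v}"

definition chromatic_polynomial :: "'a ugraph \<Rightarrow> nat \<Rightarrow> nat" where
  "chromatic_polynomial G q = card (proper_colorings G q)"


definition is_cover :: "'a ugraph \<Rightarrow> ('a \<Rightarrow> 'b set) \<Rightarrow> 'b ugraph \<Rightarrow> bool" where
  "is_cover G L H \<longleftrightarrow> simple_graph H \<and>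
     disjoint_family_on L (verts G) \<and>
     (\<forall>v\<in>verts G. independent_in H (L v)) \<and>
     verts H = (\<Union>v\<in>verts G. L v) \<and>
     (\<forall>u\<in>verts G. \<forall>v\<in>verts G. u \<noteq> v \<longrightarrow>
        matching (edges_between H (L u) (L v)) \<and>
        ({u, v} \<notin> edges G \<longrightarrow> edges_between H (L u) (L v) = {}))"

definition is_fold_cover :: "nat \<Rightarrow> 'a ugraph \<Rightarrow> ('a \<Rightarrow> 'b set) \<Rightarrow> 'b ugraph \<Rightarrow> bool" where
  "is_fold_cover q G L H \<longleftrightarrow> is_cover G L H \<and> (\<forall>v\<in>verts G. card (L v) = q)"

definition cover_colorings :: "'a ugraph \<Rightarrow> ('a \<Rightarrow> 'b set) \<Rightarrow> 'b ugraph \<Rightarrow> 'b set set" where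
  "cover_colorings G L H =
     {T. T \<subseteq> verts H \<and> (\<forall>v\<in>verts G. card (T \<inter> L v) = 1) \<and> independent_in H T}"

definition cover_count :: "'a ugraph \<Rightarrow> ('a \<Rightarrow> 'b set) \<Rightarrow> 'b ugraph \<Rightarrow> nat" where
  "cover_count G L H = card (cover_colorings G L H)"

text \<open>
  The minimum is taken over covers whose vertices are natural numbers. Every cover is finite and
  hence isomorphic to such a cover; the lemmas below show that the minimum is attained and
  is a lower bound for covers with vertices of an arbitrary type.
\<close>

definition dp_color_function :: "'a ugraph \<Rightarrow> nat \<Rightarrow> nat" where
  "dp_color_function G q =
     (LEAST k. \<exists>(L :: 'a \<Rightarrow> nat set) H. is_fold_cover q G L H \<and> cover_count G L H = k)"

lemma fold_cover_transfer:
  fixes L :: "'a \<Rightarrow> 'b set" and h :: "'b \<Rightarrow> 'c"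
  assumes cov: "is_fold_cover q G L H" and inj: "inj_on h (verts H)"
  defines "L' \<equiv> \<lambda>v. h ` L v"
    and "H' \<equiv> \<lparr>verts = h ` verts H, edges = (`) h ` edges H\<rparr>"
  shows "is_fold_cover q G L' H'" and "cover_count G L' H' = cover_count G L H"
proof -
  have indL: "\<forall>v\<in>verts G. independent_in H (L v)"
    and pairs: "\<forall>u\<in>verts G. \<forall>v\<in>verts G. u \<noteq> v \<longrightarrow>
        matching (edges_between H (L u) (L v)) \<and>
        ({u, v} \<notin> edges G \<longrightarrow> edges_between H (L u) (L v) = {})"
    and crd: "\<forall>v\<in>verts G. card (L v) = q"
    using cov unfolding is_fold_cover_def is_cover_def by simp_all
  note d = cov[unfolded is_fold_cover_def is_cover_def simple_graph_def independent_in_def]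
  have W: "verts H = (\<Union>v\<in>verts G. L v)" using d by blast
  have LW: "L v \<subseteq> verts H" if "v \<in> verts G" for v using W that by blast
  have "\<forall>e\<in>edges H. e \<subseteq> verts H \<and> card e = 2" using d by (elim conjE)
  then have eW: "e \<subseteq> verts H" "card e = 2" if "e \<in> edges H" for e using that by blast+
  have img: "h ` A = h ` B \<longleftrightarrow> A = B" if "A \<subseteq> verts H" "B \<subseteq> verts H" for A B
    using inj_on_image_eq_iff[OF inj] that by auto
  have edge: "{h x, h y} \<in> edges H' \<longleftrightarrow> {x, y} \<in> edges H"
    if "x \<in> verts H" "y \<in> verts H" for x y
  proof
    assume "{h x, h y} \<in> edges H'"
    then obtain e where e: "e \<in> edges H" "h ` {x, y} = h ` e" unfolding H'_def by auto
    then have "{x, y} = e" using img[of "{x, y}" e] eW that by auto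
    then show "{x, y} \<in> edges H" using e by simp
  next
    assume "{x, y} \<in> edges H"
    then have "h ` {x, y} \<in> edges H'" unfolding H'_def ugraph.simps by (rule imageI)
    then show "{h x, h y} \<in> edges H'" by simp
  qed
  have ind: "independent_in H' (h ` S) \<longleftrightarrow> independent_in H S" if "S \<subseteq> verts H" for S
  proof -
    have "h ` S \<subseteq> verts H'" unfolding H'_def ugraph.simps using that by (rule image_mono)
    moreover have "(\<forall>x\<in>h ` S. \<forall>y\<in>h ` S. {x, y} \<notin> edges H') \<longleftrightarrow> (\<forall>x\<in>S. \<forall>y\<in>S. {x, y} \<notin> edges H)"
      using that edge by blast
    ultimately show ?thesis using that unfolding independent_in_def by blast
  qed
  have eb: "edges_between H' (h ` S) (h ` U) = (`) h ` edges_between H S U"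
    if "S \<subseteq> verts H" "U \<subseteq> verts H" for S U
  proof (intro set_eqI iffI)
    fix e assume "e \<in> edges_between H' (h ` S) (h ` U)"
    then obtain s u where su: "s \<in> S" "u \<in> U" "e = {h s, h u}" "e \<in> edges H'"
      unfolding edges_between_def by auto
    then have "{s, u} \<in> edges H" using edge that by blast
    then have "{s, u} \<in> edges_between H S U" using su unfolding edges_between_def by auto
    then show "e \<in> (`) h ` edges_between H S U" using su by (intro image_eqI[of _ _ "{s, u}"]) auto
  next
    fix e assume "e \<in> (`) h ` edges_between H S U"
    then obtain e' where e': "e' \<in> edges_between H S U" "e = h ` e'" by blast
    then obtain s u where su: "s \<in> S" "u \<in> U" "e' = {s, u}" "e' \<in> edges H"
      unfolding edges_between_def by auto
    then have "e \<in> edges H'" using e' unfolding H'_def ugraph.simps by blast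
    moreover have "e = {h s, h u}" using e' su by simp
    ultimately show "e \<in> edges_between H' (h ` S) (h ` U)"
      using su unfolding edges_between_def by blast
  qed
  have mat: "matching ((`) h ` edges_between H S U)" if "matching (edges_between H S U)" for S U
    unfolding matching_def
  proof (rule pairwiseI)
    fix a b assume "a \<in> (`) h ` edges_between H S U" "b \<in> (`) h ` edges_between H S U" "a \<noteq> b"
    then obtain a' b' where ab: "a' \<in> edges_between H S U" "b' \<in> edges_between H S U"
      "a = h ` a'" "b = h ` b'" "a' \<noteq> b'" by auto
    then have "a' \<inter> b' = {}" using that unfolding matching_def pairwise_def disjnt_def by auto
    moreover have "a' \<subseteq> verts H" "b' \<subseteq> verts H" using ab eW unfolding edges_between_def by auto
    ultimately show "disjnt a b" using ab inj_on_image_Int[OF inj, of a' b']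
      by (auto simp: disjnt_def)
  qed
  have "is_cover G L' H'"
    unfolding is_cover_def
  proof (intro conjI ballI impI)
    show "simple_graph H'" unfolding simple_graph_def
    proof (intro conjI ballI)
      show "finite (verts H')" "verts H' \<noteq> {}" using d by (auto simp: H'_def)
      fix e assume "e \<in> edges H'"
      then obtain e' where e': "e' \<in> edges H" "e = h ` e'" by (auto simp: H'_def)
      show "e \<subseteq> verts H'" using e' eW by (auto simp: H'_def)
      show "card e = 2" using e' eW[OF e'(1)] card_image[OF inj_on_subset[OF inj]] by auto
    qed
    show "disjoint_family_on L' (verts G)" unfolding disjoint_family_on_def
    proof (intro ballI impI)
      fix u v assume uv: "u \<in> verts G" "v \<in> verts G" "u \<noteq> v"
      then have "L u \<inter> L v = {}" using d unfolding disjoint_family_on_def by blast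
      then show "L' u \<inter> L' v = {}"
        using inj_on_image_Int[OF inj LW[OF uv(1)] LW[OF uv(2)]] unfolding L'_def by auto
    qed
    show "independent_in H' (L' v)" if "v \<in> verts G" for v
      unfolding L'_def ind[OF LW[OF that]] using indL that by blast
    show "verts H' = (\<Union>v\<in>verts G. L' v)" unfolding L'_def H'_def W by auto
    fix u v assume uv: "u \<in> verts G" "v \<in> verts G" "u \<noteq> v"
    show "matching (edges_between H' (L' u) (L' v))"
      unfolding L'_def eb[OF LW[OF uv(1)] LW[OF uv(2)]] using mat pairs uv by simp
    show "edges_between H' (L' u) (L' v) = {}" if "{u, v} \<notin> edges G"
      unfolding L'_def eb[OF LW[OF uv(1)] LW[OF uv(2)]] using pairs uv that by simp
  qed
  moreover have "card (L' v) = q" if "v \<in> verts G" for v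
    using card_image[OF inj_on_subset[OF inj LW[OF that]]] crd that unfolding L'_def by simp
  ultimately show "is_fold_cover q G L' H'" unfolding is_fold_cover_def by blast
  have cs: "card (h ` T \<inter> L' v) = card (T \<inter> L v)" if "T \<subseteq> verts H" "v \<in> verts G" for T v
  proof -
    have "h ` T \<inter> L' v = h ` (T \<inter> L v)"
      using inj_on_image_Int[OF inj that(1) LW[OF that(2)]] unfolding L'_def by simp
    then show ?thesis using card_image[OF inj_on_subset[OF inj, of "T \<inter> L v"]] that(1) by auto
  qed
  have "cover_colorings G L' H' = (`) h ` cover_colorings G L H"
  proof (intro set_eqI iffI)
    fix T' assume T': "T' \<in> cover_colorings G L' H'"
    then have "T' \<subseteq> h ` verts H" unfolding cover_colorings_def H'_def by simp
    then obtain T where T: "T \<subseteq> verts H" "T' = h ` T" by (meson subset_imageE)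
    then have "T \<in> cover_colorings G L H" using T' cs ind
      unfolding cover_colorings_def by simp
    then show "T' \<in> (`) h ` cover_colorings G L H" using T by blast
  next
    fix T' assume "T' \<in> (`) h ` cover_colorings G L H"
    then show "T' \<in> cover_colorings G L' H'" using cs ind
      unfolding cover_colorings_def by (auto simp: H'_def)
  qed
  moreover have "inj_on ((`) h) (cover_colorings G L H)"
    using img unfolding cover_colorings_def inj_on_def by blast
  ultimately show "cover_count G L' H' = cover_count G L H"
    unfolding cover_count_def by (simp add: card_image)
qed

lemma dp_color_function_le:
  fixes L :: "'a \<Rightarrow> 'b set"
  assumes "is_fold_cover q G L H"
  shows "dp_color_function G q \<le> cover_count G L H"
proof -
  have "finite (verts H)" using assms unfolding is_fold_cover_def is_cover_def simple_graph_def by blast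
  then obtain h :: "'b \<Rightarrow> nat" where "inj_on h (verts H)"
    by (metis finite_imp_inj_to_nat_seg)
  note t = fold_cover_transfer[OF assms this]
  show ?thesis unfolding dp_color_function_def by (rule Least_le) (use t in blast)
qed

lemma dp_color_function_attained:
  fixes G :: "'a ugraph"
  assumes G: "simple_graph G" and q: "q \<ge> 1"
  obtains L :: "'a \<Rightarrow> nat set" and H
  where "is_fold_cover q G L H" "cover_count G L H = dp_color_function G q"
proof -
  let ?L = "\<lambda>v. {v} \<times> {1..q}" and ?H = "\<lparr>verts = verts G \<times> {1..q}, edges = {}\<rparr>"
  have fc: "is_fold_cover q G ?L ?H"
    unfolding is_fold_cover_def is_cover_def
  proof (intro conjI ballI impI)
    show "simple_graph ?H" using G q unfolding simple_graph_def by simp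
    show "disjoint_family_on ?L (verts G)" unfolding disjoint_family_on_def by blast
    show "independent_in ?H (?L v)" if "v \<in> verts G" for v
      using that unfolding independent_in_def by auto
    show "verts ?H = (\<Union>v\<in>verts G. ?L v)" by auto
    show "card (?L v) = q" for v :: 'a by (simp add: card_cartesian_product)
  qed (simp_all add: edges_between_def matching_def)
  have "finite (verts ?H)" using G unfolding simple_graph_def by simp
  then obtain h :: "'a \<times> nat \<Rightarrow> nat" where "inj_on h (verts ?H)"
    by (metis finite_imp_inj_to_nat_seg)
  then have "\<exists>k (L :: 'a \<Rightarrow> nat set) H. is_fold_cover q G L H \<and> cover_count G L H = k"
    using fold_cover_transfer(1)[OF fc] by blast
  from LeastI_ex[OF this] show thesis
    using that unfolding dp_color_function_def by blast
qed

end

theory Submission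
  imports Defs "HOL-Number_Theory.Cong"
begin

text \<open>
  Let \<open>r = g + 1\<close> be the girth, an even number. The proper colourings of a \<open>q\<close>-fold cover are counted by
  inclusion--exclusion: sum \<open>(-1) ^ card A\<close> times the number of maps violating every edge of \<open>A\<close>, over
  the edge sets \<open>A\<close> of \<open>G\<close> (\<open>card_unmatched_maps\<close>). Suppose that all matchings of the cover are
  perfect. If \<open>A\<close> is a forest, the number of these maps is \<open>q ^ (n - card A)\<close>, whatever the matchings are
  (\<open>card_matched_maps_forest\<close>). An edge set with at most \<open>r\<close> edges is a forest unless it is an
  \<open>r\<close>-cycle, and a set with more than \<open>r\<close> edges contains a forest with \<open>r\<close> edges, so that its term is
  at most \<open>q ^ (n - r)\<close>. Hence, up to an error of at most \<open>2 ^ m * q ^ (n - r)\<close>, which does not depend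
  on the cover, the counts for two such systems of matchings differ only through the \<open>r\<close>-cycles
  (\<open>unmatched_maps_diff_estimate\<close>).

  Ordinary colouring is one such system, and in it every \<open>r\<close>-cycle is violated by
  \<open>q ^ (n - r + 1) = q ^ (n - g)\<close> maps. Since \<open>r\<close> is even, these numbers enter with positive sign. In any
  other system they are at least zero, so that the \<open>r\<close>-cycles contribute at most \<open>t * q ^ (n - g)\<close> to the
  difference. This upper bound carries over from perfect matchings to all covers, because completing
  the matchings can only destroy colourings (\<open>ex_perfect_extension\<close>).

  For the lower bound a single cover is needed in which no map violates all edges of an \<open>r\<close>-cycle.
  Let the colours \<open>i\<close> and \<open>j\<close> be matched over the edge \<open>e\<close> when \<open>i + j\<close> is congruent to \<open>c e\<close> modulo \<open>q\<close>.
  A map violating all edges of an even cycle makes the alternating sum of \<open>c e\<close> over the cycle divisible by \<open>q\<close>,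
  which is impossible for large \<open>q\<close> when the values \<open>c e\<close> are distinct powers of two
  (\<open>sum_cover_even_cycle\<close>).
\<close>

section \<open>Inclusion--exclusion over edge sets\<close>

text \<open>
  A colouring is a map \<open>f\<close> choosing one element of \<open>L v\<close> for every vertex \<open>v\<close>, and an edge \<open>e\<close> is
  violated when the image \<open>f ` e\<close> belongs to a family \<open>W\<close> of forbidden sets. Taking \<open>W\<close> to be the edge
  set of a cover gives the proper colourings of that cover. Taking every \<open>L v\<close> equal to \<open>{1..q}\<close> and
  \<open>W\<close> the family of singletons gives the ordinary colourings, because \<open>f ` {u, v}\<close> is a singleton
  iff \<open>f u = f v\<close>. One argument therefore treats both counts.
\<close>

definition matched_maps :: "'a set \<Rightarrow> ('a \<Rightarrow> 'b set) \<Rightarrow> 'b set set \<Rightarrow> 'a set set \<Rightarrow> ('a \<Rightarrow> 'b) set" where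
  "matched_maps V L W A = {f \<in> PiE V L. \<forall>e\<in>A. f ` e \<in> W}"

definition unmatched_maps :: "'a set \<Rightarrow> ('a \<Rightarrow> 'b set) \<Rightarrow> 'b set set \<Rightarrow> 'a set set \<Rightarrow> ('a \<Rightarrow> 'b) set" where
  "unmatched_maps V L W A = {f \<in> PiE V L. \<forall>e\<in>A. f ` e \<notin> W}"

lemma matched_maps_antimono: "A \<subseteq> B \<Longrightarrow> matched_maps V L W B \<subseteq> matched_maps V L W A"
  by (auto simp: matched_maps_def)

text \<open>
  Expand the product of \<open>1 - b f e\<close> over the edges \<open>e\<close>, where \<open>b f e\<close> indicates that \<open>f\<close> violates \<open>e\<close>,
  and sum over \<open>f\<close>.
\<close>

lemma card_unmatched_maps:
  assumes V: "finite V" and L: "\<And>v. v \<in> V \<Longrightarrow> finite (L v)" and E: "finite E"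
  shows "int (card (unmatched_maps V L W E)) =
    (\<Sum>A\<in>Pow E. (-1) ^ card A * int (card (matched_maps V L W A)))"
proof -
  define X where "X = PiE V L"
  have X: "finite X" unfolding X_def using V L by (intro finite_PiE) auto
  define b where "b f e = (if f ` e \<in> W then 1 else 0 :: int)" for f :: "'a \<Rightarrow> 'b" and e
  have ind: "(\<Prod>e\<in>A. b f e) = (if \<forall>e\<in>A. f ` e \<in> W then 1 else 0)" if "finite A" for A f
    using that by (induction A rule: finite_induct) (auto simp: b_def)
  have ind0: "(\<Prod>e\<in>A. 1 - b f e) = (if \<forall>e\<in>A. f ` e \<notin> W then 1 else 0)" if "finite A" for A f
    using that by (induction A rule: finite_induct) (auto simp: b_def)
  have "int (card (unmatched_maps V L W E)) = (\<Sum>f\<in>X. \<Prod>e\<in>E. 1 - b f e)"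
    unfolding ind0[OF E] unmatched_maps_def X_def[symmetric]
    using X by (simp add: sum.If_cases Int_def)
  also have "\<dots> = (\<Sum>f\<in>X. \<Prod>e\<in>E. (- b f e) + 1)" by simp
  also have "\<dots> = (\<Sum>f\<in>X. \<Sum>A\<in>Pow E. (-1) ^ card A * (\<Prod>e\<in>A. b f e))"
    unfolding prod_add[OF E] by (simp add: prod_uminus)
  also have "\<dots> = (\<Sum>A\<in>Pow E. \<Sum>f\<in>X. (-1) ^ card A * (\<Prod>e\<in>A. b f e))" by (rule sum.swap)
  also have "\<dots> = (\<Sum>A\<in>Pow E. (-1) ^ card A * int (card (matched_maps V L W A)))"
  proof (intro sum.cong refl)
    fix A assume "A \<in> Pow E"
    then have A: "finite A" using E finite_subset by auto
    show "(\<Sum>f\<in>X. (-1) ^ card A * (\<Prod>e\<in>A. b f e)) = (-1) ^ card A * int (card (matched_maps V L W A))"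
      unfolding ind[OF A] matched_maps_def X_def[symmetric] sum_distrib_left[symmetric]
      using X by (simp add: sum.If_cases Int_def)
  qed
  finally show ?thesis .
qed

section \<open>Forests\<close>

text \<open>
  The forbidden pairs over each edge form a perfect matching of the two lists. The lists may
  overlap, so that ordinary colouring, where they all coincide, is an instance.
\<close>

definition perfect_on :: "'a ugraph \<Rightarrow> nat \<Rightarrow> ('a \<Rightarrow> 'b set) \<Rightarrow> 'b set set \<Rightarrow> bool" where
  "perfect_on G q L W \<longleftrightarrow> (\<forall>v\<in>verts G. finite (L v) \<and> card (L v) = q) \<and>
     (\<forall>u v x. {u, v} \<in> edges G \<longrightarrow> x \<in> L u \<longrightarrow> (\<exists>!y. y \<in> L v \<and> {x, y} \<in> W))"

lemma perfect_onD:
  assumes "perfect_on G q L W" "{u, v} \<in> edges G" "x \<in> L u"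
  shows "\<exists>!y. y \<in> L v \<and> {x, y} \<in> W"
  using assms unfolding perfect_on_def by blast

lemma simple_graph_edgeE:
  assumes "simple_graph G" "e \<in> edges G"
  obtains u v where "e = {u, v}" "u \<noteq> v" "u \<in> verts G" "v \<in> verts G"
proof -
  have e: "card e = 2" "e \<subseteq> verts G" using assms by (auto simp: simple_graph_def)
  from e(1) obtain u v where "e = {u, v}" "u \<noteq> v" unfolding card_2_iff by blast
  then show thesis using that[of u v] e(2) by simp
qed

lemma simple_graph_finite_edges: "simple_graph G \<Longrightarrow> finite (edges G)"
  by (rule finite_subset[of _ "Pow (verts G)"]) (auto simp: simple_graph_def)

text \<open>
  If \<open>v\<close> lies on no edge of \<open>A\<close>, its colour is free in the maps matched on \<open>A\<close>, whereas adding the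
  edge \<open>e = {u, v}\<close> forces it to be the unique mate of the colour of \<open>u\<close>. Overwriting the colour of
  \<open>v\<close> is the bijection that compares the two counts.
\<close>

lemma card_matched_maps_pendant:
  fixes L :: "'a \<Rightarrow> 'b set"
  assumes G: "simple_graph G" and perf: "perfect_on G q L W"
    and e: "e \<in> edges G" "v \<in> e" and A: "A \<subseteq> edges G" "v \<notin> \<Union>A"
  shows "card (matched_maps (verts G) L W (insert e A)) * q = card (matched_maps (verts G) L W A)"
proof -
  let ?V = "verts G"
  obtain a b where ab: "e = {a, b}" "a \<noteq> b" "a \<in> ?V" "b \<in> ?V"
    using simple_graph_edgeE[OF G e(1)] .
  define u where "u = (if v = a then b else a)"
  have u: "e = {u, v}" "u \<noteq> v" "u \<in> ?V" "v \<in> ?V"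
    using ab e(2) by (auto simp: u_def)
  define mate where "mate x = (THE y. y \<in> L v \<and> {x, y} \<in> W)" for x
  have uniq: "\<exists>!y. y \<in> L v \<and> {x, y} \<in> W" if "x \<in> L u" for x
    using perfect_onD[OF perf, of u v x] that e(1) u(1) by simp
  have mate: "mate x \<in> L v" "{x, mate x} \<in> W" if "x \<in> L u" for x
    using theI'[OF uniq[OF that]] unfolding mate_def by auto
  have mate_eq: "y = mate x" if "x \<in> L u" "y \<in> L v" "{x, y} \<in> W" for x y
    using uniq mate that by blast
  have upd: "f(v := x) ` d = f ` d" if "d \<in> A" for f :: "'a \<Rightarrow> 'b" and x d
    using that A by (intro image_cong) auto
  have "bij_betw (\<lambda>(f, x). f(v := x)) (matched_maps ?V L W (insert e A) \<times> L v) (matched_maps ?V L W A)"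
  proof (rule bij_betw_byWitness[where f' = "\<lambda>f. (f(v := mate (f u)), f v)"])
    show "\<forall>p\<in>matched_maps ?V L W (insert e A) \<times> L v.
        (\<lambda>f. (f(v := mate (f u)), f v)) ((\<lambda>(f, x). f(v := x)) p) = p"
    proof
      fix p assume "p \<in> matched_maps ?V L W (insert e A) \<times> L v"
      then obtain f x where p: "p = (f, x)" "f \<in> matched_maps ?V L W (insert e A)" by auto
      then have "f v = mate (f u)" using u by (intro mate_eq) (auto simp: matched_maps_def)
      then have "f(v := mate (f u)) = f" by (simp add: fun_upd_idem)
      then show "(\<lambda>f. (f(v := mate (f u)), f v)) ((\<lambda>(f, x). f(v := x)) p) = p"
        using u by (simp add: p)
    qed
    show "\<forall>f\<in>matched_maps ?V L W A.
        (\<lambda>(f, x). f(v := x)) ((\<lambda>f. (f(v := mate (f u)), f v)) f) = f" by auto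
    show "(\<lambda>(f, x). f(v := x)) ` (matched_maps ?V L W (insert e A) \<times> L v) \<subseteq> matched_maps ?V L W A"
    proof (intro image_subsetI, elim SigmaE, simp only: prod.case)
      fix f x assume f: "f \<in> matched_maps ?V L W (insert e A)" "x \<in> L v"
      then have "f(v := x) \<in> PiE ?V L" using u by (auto simp: matched_maps_def PiE_iff extensional_def)
      then show "f(v := x) \<in> matched_maps ?V L W A" using f upd by (simp add: matched_maps_def)
    qed
    show "(\<lambda>f. (f(v := mate (f u)), f v)) ` matched_maps ?V L W A
        \<subseteq> matched_maps ?V L W (insert e A) \<times> L v"
    proof (intro image_subsetI SigmaI)
      fix f assume f: "f \<in> matched_maps ?V L W A"
      then have fL: "f u \<in> L u" "f v \<in> L v" using u by (auto simp: matched_maps_def)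
      then have "f(v := mate (f u)) \<in> PiE ?V L"
        using f u mate by (auto simp: matched_maps_def PiE_iff extensional_def)
      moreover have "f(v := mate (f u)) ` e \<in> W" using u mate fL by simp
      ultimately show "f(v := mate (f u)) \<in> matched_maps ?V L W (insert e A)"
        using f upd by (simp add: matched_maps_def)
      show "f v \<in> L v" by (fact fL)
    qed
  qed
  then have "card (matched_maps ?V L W (insert e A) \<times> L v) = card (matched_maps ?V L W A)"
    by (rule bij_betw_same_card)
  moreover have "card (L v) = q" using perf u by (auto simp: perfect_on_def)
  ultimately show ?thesis by (simp add: card_cartesian_product)
qed

text \<open>
  On a finite edge set this says that every vertex it touches has degree at least two. Forests are
  treated below as edge sets all of whose leafless subsets are empty.
\<close>

definition leafless :: "'a set set \<Rightarrow> bool" where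
  "leafless A \<longleftrightarrow> (\<forall>v\<in>\<Union>A. card {e \<in> A. v \<in> e} \<noteq> 1)"

text \<open>
  Removing pendant edges one at a time divides the number of all maps by \<open>q\<close> for every edge. The
  value does not depend on the matchings, which is why forests cancel when two covers are compared.
\<close>

lemma card_matched_maps_forest:
  assumes G: "simple_graph G" and perf: "perfect_on G q L W" and A: "A \<subseteq> edges G"
    and forest: "\<And>B. B \<subseteq> A \<Longrightarrow> leafless B \<Longrightarrow> B = {}"
  shows "card (matched_maps (verts G) L W A) * q ^ card A = q ^ card (verts G)"
proof -
  have "finite A" using A simple_graph_finite_edges[OF G] finite_subset by blast
  then show ?thesis using A forest
  proof (induction A rule: finite_psubset_induct)
    case (psubset A)
    show ?case
    proof (cases "A = {}")
      case True
      have "card (PiE (verts G) L) = (\<Prod>v\<in>verts G. card (L v))"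
        using G by (simp add: card_PiE simple_graph_def)
      also have "\<dots> = q ^ card (verts G)"
        using perf by (simp add: perfect_on_def)
      finally show ?thesis using True by (simp add: matched_maps_def)
    next
      case False
      then have "\<not> leafless A" using psubset.prems by blast
      then obtain v where "card {e \<in> A. v \<in> e} = 1" unfolding leafless_def by blast
      then obtain e where e: "{e \<in> A. v \<in> e} = {e}" by (auto simp: card_1_singleton_iff)
      define B where "B = A - {e}"
      have eA: "e \<in> A" "v \<in> e" and vB: "v \<notin> \<Union>B" using e unfolding B_def by blast+
      have B: "B \<subset> A" "A = insert e B" "e \<notin> B" using eA(1) by (auto simp: B_def)
      have BE: "B \<subseteq> edges G" "e \<in> edges G" using eA psubset.prems(1) B(1) by auto
      have "card (matched_maps (verts G) L W A) * q = card (matched_maps (verts G) L W B)"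
        using card_matched_maps_pendant[OF G perf BE(2) eA(2) BE(1) vB] by (simp only: B(2)[symmetric])
      moreover have "card (matched_maps (verts G) L W B) * q ^ card B = q ^ card (verts G)"
        using psubset.IH[OF B(1)] psubset.prems B(1) by blast
      moreover have "card A = Suc (card B)"
        unfolding B_def using eA(1) psubset.hyps by (simp only: card.remove)
      ultimately show ?thesis by (simp add: mult.assoc[symmetric])
    qed
  qed
qed

section \<open>Cycles in edge sets of minimum degree two\<close>

lemma is_cycleE:
  assumes "is_cycle k C"
  obtains vs where "3 \<le> length vs" "length vs = k" "distinct vs" "verts C = set vs"
    "edges C = (\<lambda>i. {vs ! i, vs ! (Suc i mod length vs)}) ` {..<length vs}"
proof -
  from assms obtain vs where vs: "3 \<le> k" "length vs = k" "distinct vs" "verts C = set vs"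
    "edges C = {{vs ! i, vs ! (Suc i mod k)} | i. i < k}"
    unfolding is_cycle_def by blast
  have "edges C = (\<lambda>i. {vs ! i, vs ! (Suc i mod length vs)}) ` {..<length vs}"
    unfolding vs(5) vs(2) by auto
  then show thesis using that vs(1-4) by simp
qed

text \<open>
  Take a longest path. All neighbours of its first vertex \<open>z\<close> lie on the path, since otherwise the
  path could be prolonged. As \<open>z\<close> has two neighbours, one of them is at least two steps away along
  the path, and the edge back to \<open>z\<close> closes a cycle.
\<close>

lemma leafless_imp_cycle:
  assumes A: "A \<noteq> {}" "finite A" "\<And>e. e \<in> A \<Longrightarrow> card e = 2" and deg: "leafless A"
  obtains C k where "is_cycle k C" "verts C \<subseteq> \<Union>A" "edges C \<subseteq> A"
proof -
  \<comment> \<open>\<open>P p\<close>: the list \<open>p\<close> is a path all of whose edges lie in \<open>A\<close>.\<close>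
  define P where "P p \<longleftrightarrow> p \<noteq> [] \<and> distinct p \<and> set p \<subseteq> \<Union>A \<and>
    (\<forall>i. Suc i < length p \<longrightarrow> {p ! i, p ! Suc i} \<in> A)" for p
  have fin: "finite (\<Union>A)" using A by (metis finite_Union card.infinite zero_neq_numeral)
  obtain e where "e \<in> A" using A by auto
  then obtain x where "x \<in> \<Union>A" using A(3) by (metis Union_iff card.empty equals0I zero_neq_numeral)
  then have "P [x]" by (simp add: P_def)
  moreover have "\<forall>p. P p \<longrightarrow> length p < Suc (card (\<Union>A))"
    using fin by (auto simp: P_def less_Suc_eq_le distinct_card[symmetric] intro!: card_mono)
  ultimately obtain p where p: "P p" and max: "\<And>p'. P p' \<Longrightarrow> length p' \<le> length p"
    using ex_has_greatest_nat[of P "[x]" length "Suc (card (\<Union>A))"] by blast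
  define z where "z = p ! 0"
  have p0: "p \<noteq> []" using p by (simp add: P_def)
  have zA: "z \<in> \<Union>A" using p p0 unfolding P_def z_def by (meson nth_mem length_greater_0_conv subset_iff)
  have nbr: "\<exists>j. 0 < j \<and> j < length p \<and> d = {z, p ! j}" if d: "d \<in> A" "z \<in> d" for d
  proof -
    obtain y where y: "d = {z, y}" "y \<noteq> z"
      using A(3)[OF d(1)] d(2) by (auto simp: card_2_iff)
    have "y \<in> set p"
    proof (rule ccontr)
      assume "y \<notin> set p"
      then have "P (y # p)" using p d y p0 unfolding P_def z_def
        by (auto simp: nth_Cons' insert_commute gr0_conv_Suc)
      then show False using max by fastforce
    qed
    then obtain j where "j < length p" "p ! j = y" by (auto simp: in_set_conv_nth)
    then show ?thesis using y by (intro exI[of _ j]) (auto simp: z_def intro: gr0I)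
  qed
  have "card {d \<in> A. z \<in> d} \<noteq> 1" "{d \<in> A. z \<in> d} \<noteq> {}"
    using deg zA by (auto simp: leafless_def)
  then have "\<exists>d1 d2. d1 \<in> A \<and> z \<in> d1 \<and> d2 \<in> A \<and> z \<in> d2 \<and> d1 \<noteq> d2"
    by (smt (verit) all_not_in_conv is_singletonI' is_singleton_altdef mem_Collect_eq)
  then obtain d1 d2 where "d1 \<in> A" "z \<in> d1" "d2 \<in> A" "z \<in> d2" "d1 \<noteq> d2" by blast
  then obtain j1 j2 where "0 < j1" "j1 < length p" "{z, p ! j1} \<in> A"
    "0 < j2" "j2 < length p" "{z, p ! j2} \<in> A" "j1 \<noteq> j2" using nbr by metis
  then obtain j where j: "2 \<le> j" "j < length p" "{z, p ! j} \<in> A"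
    by (metis One_nat_def Suc_leI nat_neq_iff numeral_2_eq_2 order_le_less_trans)
  define vs where "vs = take (Suc j) p"
  define C where "C = \<lparr>verts = set vs, edges = {{vs ! i, vs ! (Suc i mod Suc j)} | i. i < Suc j}\<rparr>"
  have len: "length vs = Suc j" using j by (simp add: vs_def)
  have "is_cycle (Suc j) C"
    unfolding is_cycle_def
  proof (intro conjI exI[of _ vs])
    show "distinct vs" using p by (simp add: vs_def P_def)
  qed (use j len in \<open>simp_all add: C_def\<close>)
  moreover have "verts C \<subseteq> \<Union>A" using p set_take_subset[of "Suc j" p] by (auto simp: C_def vs_def P_def)
  moreover have "edges C \<subseteq> A"
  proof
    fix d assume "d \<in> edges C"
    then obtain i where i: "i < Suc j" "d = {vs ! i, vs ! (Suc i mod Suc j)}" by (auto simp: C_def)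
    show "d \<in> A"
    proof (cases "i = j")
      case True
      then show ?thesis using i j by (simp add: vs_def z_def insert_commute)
    next
      case False
      then show ?thesis using i j p by (simp add: vs_def P_def)
    qed
  qed
  ultimately show thesis using that by blast
qed

text \<open>
  This needs length at least three: for two vertices the forward and the backward edge coincide.
\<close>

lemma cyclic_edges_inj:
  assumes "3 \<le> length vs" "distinct vs"
  shows "inj_on (\<lambda>i. {vs ! i, vs ! (Suc i mod length vs)}) {..<length vs}"
proof (rule inj_onI)
  let ?k = "length vs"
  fix i j assume ij: "i \<in> {..<?k}" "j \<in> {..<?k}"
    and eq: "{vs ! i, vs ! (Suc i mod ?k)} = {vs ! j, vs ! (Suc j mod ?k)}"
  have lt: "Suc a mod ?k < ?k" for a using assms(1) by (intro mod_less_divisor) linarith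
  from eq consider "vs ! i = vs ! j" | "vs ! i = vs ! (Suc j mod ?k)" "vs ! (Suc i mod ?k) = vs ! j"
    by (auto simp: doubleton_eq_iff)
  then show "i = j"
  proof cases
    case 1
    then show ?thesis using assms ij by (simp add: nth_eq_iff_index_eq)
  next
    case 2
    then have "i = Suc j mod ?k" "Suc i mod ?k = j"
      using assms ij lt by (simp_all add: nth_eq_iff_index_eq)
    then show ?thesis using assms(1) ij by (auto simp: mod_Suc split: if_splits)
  qed
qed

lemma is_cycle_card_edges:
  assumes "is_cycle k C" shows "card (edges C) = k" "finite (edges C)" "\<Union>(edges C) = verts C"
proof -
  obtain vs where vs: "3 \<le> length vs" "length vs = k" "distinct vs" "verts C = set vs"
     "edges C = (\<lambda>i. {vs ! i, vs ! (Suc i mod length vs)}) ` {..<length vs}"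
    using assms by (rule is_cycleE)
  show "card (edges C) = k" using vs cyclic_edges_inj[OF vs(1,3)] by (simp add: card_image)
  show "finite (edges C)" using vs by simp
  have "Suc i mod length vs < length vs" for i using vs(1) by (intro mod_less_divisor) linarith
  then show "\<Union>(edges C) = verts C" unfolding vs(4,5) by (auto simp: set_conv_nth)
qed

lemma is_cycle_degree:
  assumes C: "is_cycle k C" and v: "v \<in> verts C"
  shows "card {e \<in> edges C. v \<in> e} = 2"
proof -
  obtain vs where vs: "3 \<le> length vs" "length vs = k" "distinct vs" "verts C = set vs"
     "edges C = (\<lambda>i. {vs ! i, vs ! (Suc i mod length vs)}) ` {..<length vs}"
    using C by (rule is_cycleE)
  let ?k = "length vs"
  let ?d = "\<lambda>i. {vs ! i, vs ! (Suc i mod ?k)}"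
  obtain j where j: "j < ?k" "v = vs ! j" using v vs by (auto simp: in_set_conv_nth)
  \<comment> \<open>The cyclic predecessor of \<open>j\<close>: the edges at \<open>vs ! j\<close> are those numbered \<open>j\<close> and \<open>j'\<close>.\<close>
  define j' where "j' = (if j = 0 then ?k - 1 else j - 1)"
  have lt: "Suc a mod ?k < ?k" for a using vs(1) by (intro mod_less_divisor) linarith
  have j': "j' < ?k" "j' \<noteq> j" "Suc j' mod ?k = j" using j vs(1) by (auto simp: j'_def)
  have mem: "v \<in> ?d i \<longleftrightarrow> i = j \<or> i = j'" if "i < ?k" for i
    using that j j' lt[of i] vs(1,3)
    by (auto simp: nth_eq_iff_index_eq mod_Suc j'_def split: if_splits)
  have "{e \<in> edges C. v \<in> e} = ?d ` {j, j'}" unfolding vs(5) using mem j j' by auto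
  moreover have "inj_on ?d {j, j'}"
    by (rule inj_on_subset[OF cyclic_edges_inj[OF vs(1,3)]]) (use j j' in auto)
  ultimately show ?thesis using j' by (simp add: card_image)
qed

text \<open>
  After deleting \<open>e\<close> from a cycle both ends of \<open>e\<close> have degree one. If adding \<open>e'\<close> makes a cycle again,
  then \<open>e'\<close> raises the degree at both ends, so \<open>e' = e\<close>. This is what separates cycles of minimum
  length from larger edge sets below.
\<close>

lemma cycle_exchange:
  assumes C: "is_cycle k C" and C': "is_cycle k' C'" and ed: "edges C' = insert e' (edges C - {e})"
    and e: "e \<in> edges C" "e' \<notin> edges C" and c: "card e = 2" "card e' = 2"
  shows False
proof -
  have "v \<in> e'" if v: "v \<in> e" for v
  proof (rule ccontr)
    assume ne: "v \<notin> e'"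
    have "v \<in> verts C" using v e is_cycle_card_edges(3)[OF C] by auto
    then have two: "card {d \<in> edges C. v \<in> d} = 2" by (rule is_cycle_degree[OF C])
    have "{d \<in> edges C'. v \<in> d} = {d \<in> edges C. v \<in> d} - {e}" using ne ed by auto
    then have one: "card {d \<in> edges C'. v \<in> d} = 1" using two e v by simp
    then have "{d \<in> edges C'. v \<in> d} \<noteq> {}" by force
    then have "v \<in> verts C'" using is_cycle_card_edges(3)[OF C'] by auto
    then show False using is_cycle_degree[OF C'] one by auto
  qed
  then have "e \<subseteq> e'" by blast
  then have "e = e'" using c by (metis card_subset_eq card.infinite zero_neq_numeral)
  then show False using e by simp
qed

section \<open>Edge sets of size up to the girth\<close>

lemma girth_le:
  assumes "C \<in> cycles G k" "girth G = enat r" shows "r \<le> k"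
proof -
  have "girth G \<le> enat k" unfolding girth_def using assms(1) by (intro Inf_lower) blast
  then show ?thesis using assms(2) by simp
qed

lemma girth_attained:
  assumes "girth G = enat r" shows "cycles G r \<noteq> {}"
proof -
  define K where "K = {enat k | k. cycles G k \<noteq> {}}"
  have "Inf K = enat r" using assms by (simp add: girth_def K_def)
  moreover from this have "K \<noteq> {}" by (auto simp: Inf_enat_def)
  ultimately have "enat r \<in> K" by (metis Inf_enat_def LeastI ex_in_conv)
  then show ?thesis by (auto simp: K_def)
qed

text \<open>
  A leafless set contains a cycle, which already has at least \<open>r\<close> edges; if the set has exactly \<open>r\<close>
  edges, nothing else is left in it.
\<close>

lemma leafless_girth:
  assumes G: "simple_graph G" and gr: "girth G = enat r"
    and A: "A \<subseteq> edges G" "A \<noteq> {}" "leafless A"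
  shows "r \<le> card A" and "card A = r \<Longrightarrow> A \<in> edges ` cycles G r"
proof -
  have finA: "finite A" using A(1) simple_graph_finite_edges[OF G] finite_subset by blast
  have two: "card e = 2" if "e \<in> A" for e using that A(1) G by (auto simp: simple_graph_def)
  obtain C k where C: "is_cycle k C" "verts C \<subseteq> \<Union>A" "edges C \<subseteq> A"
    using leafless_imp_cycle[OF A(2) finA two A(3)] .
  have "\<Union>A \<subseteq> verts G" using A(1) G by (auto simp: simple_graph_def)
  then have cyc: "C \<in> cycles G k" using C A(1) by (auto simp: cycles_def subgraph_def)
  then have rk: "r \<le> k" using girth_le gr by blast
  have kA: "k \<le> card A" using card_mono[OF finA C(3)] is_cycle_card_edges(1)[OF C(1)] by simp
  show "r \<le> card A" using rk kA by simp
  assume r: "card A = r"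
  then have "edges C = A"
    using rk kA is_cycle_card_edges(1)[OF C(1)] card_subset_eq[OF finA C(3)] by simp
  then show "A \<in> edges ` cycles G r" using cyc rk kA r by auto
qed

lemma forest_below_girth:
  assumes G: "simple_graph G" and gr: "girth G = enat r"
    and A: "A \<subseteq> edges G" "card A \<le> r" "A \<notin> edges ` cycles G r"
    and B: "B \<subseteq> A" "leafless B"
  shows "B = {}"
proof (rule ccontr)
  assume ne: "B \<noteq> {}"
  have finA: "finite A" using A(1) simple_graph_finite_edges[OF G] finite_subset by blast
  have BE: "B \<subseteq> edges G" using A B by blast
  have "r \<le> card B" using leafless_girth(1)[OF G gr BE ne B(2)] .
  then have "B = A" using A(2) card_seteq[OF finA B(1)] by simp
  moreover have "card B = r" using \<open>r \<le> card B\<close> A(2) \<open>B = A\<close> by simp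
  ultimately show False using leafless_girth(2)[OF G gr BE ne B(2)] A(3) by simp
qed

text \<open>
  Start from any \<open>r\<close> edges of \<open>A\<close>. If they form a cycle, exchange one of them for an edge of \<open>A\<close>
  outside; by \<open>cycle_exchange\<close> the result is not a cycle. By \<open>forest_below_girth\<close> the set \<open>F\<close> obtained
  is a forest, so the maps matched on \<open>A\<close> are few.
\<close>

lemma ex_noncycle_subset:
  assumes G: "simple_graph G" and A: "A \<subseteq> edges G" "r < card A" and r: "0 < r"
  obtains F where "F \<subseteq> A" "card F = r" "F \<notin> edges ` cycles G r"
proof -
  have finA: "finite A" using A(1) simple_graph_finite_edges[OF G] finite_subset by blast
  obtain B where B: "B \<subseteq> A" "card B = r" using obtain_subset_with_card_n[of r A] A(2) by auto
  have finB: "finite B" using B finA finite_subset by blast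
  have "B \<noteq> A" "B \<noteq> {}" using A(2) B r by auto
  then obtain e e' where e: "e \<in> B" "e' \<in> A" "e' \<notin> B" using B(1) by blast
  define F where "F = insert e' (B - {e})"
  have "card F = r" using e B r finB by (simp add: F_def card_Diff_singleton)
  have c: "card e = 2" "card e' = 2" using e A(1) B(1) G by (auto simp: simple_graph_def)
  show thesis
  proof (cases "B \<in> edges ` cycles G r \<and> F \<in> edges ` cycles G r")
    case True
    then obtain C C' where C: "is_cycle r C" "edges C = B" "is_cycle r C'" "edges C' = F"
      by (auto simp: cycles_def)
    then show thesis using cycle_exchange[OF C(1,3), of e' e] e c by (auto simp: F_def)
  next
    case False
    then show thesis using that[of B] that[of F] B e \<open>card F = r\<close> by (auto simp: F_def)
  qed
qed

lemma cycles_card_le: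
  assumes "simple_graph G" "C \<in> cycles G k" shows "k \<le> card (verts G)"
proof -
  obtain vs where "length vs = k" "distinct vs" "verts C = set vs"
    using assms(2) by (auto simp: cycles_def elim: is_cycleE)
  then have "card (verts C) = k" by (simp add: distinct_card)
  then show ?thesis using assms by (auto simp: cycles_def subgraph_def simple_graph_def intro!: card_mono)
qed

text \<open>
  Counting cycles as subgraphs agrees with counting their edge sets, since a cycle has no isolated
  vertices.
\<close>

lemma inj_on_edges_cycles: "inj_on edges (cycles G k)"
proof (rule inj_onI)
  fix C D assume CD: "C \<in> cycles G k" "D \<in> cycles G k" "edges C = edges D"
  then have "verts C = verts D"
    using is_cycle_card_edges(3)[of k C] is_cycle_card_edges(3)[of k D] by (simp add: cycles_def)
  then show "C = D" using CD(3) by (intro ugraph.equality) simp_all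
qed

lemma finite_matched_maps:
  assumes "simple_graph G" "perfect_on G q L W" shows "finite (matched_maps (verts G) L W A)"
proof (rule finite_subset)
  show "matched_maps (verts G) L W A \<subseteq> PiE (verts G) L" by (auto simp: matched_maps_def)
  show "finite (PiE (verts G) L)"
    using assms by (intro finite_PiE) (auto simp: simple_graph_def perfect_on_def)
qed

section \<open>Comparing two systems of perfect matchings\<close>

lemma matched_maps_noncycle:
  assumes G: "simple_graph G" and gr: "girth G = enat r" and perf: "perfect_on G q L W" and q: "0 < q"
    and A: "A \<subseteq> edges G" "card A \<le> r" "A \<notin> edges ` cycles G r"
  shows "card (matched_maps (verts G) L W A) = q ^ (card (verts G) - card A)"
proof -
  obtain C where "C \<in> cycles G r" using girth_attained[OF gr] by blast
  then have "card A \<le> card (verts G)" using cycles_card_le[OF G] A(2) by fastforce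
  moreover have "card (matched_maps (verts G) L W A) * q ^ card A = q ^ card (verts G)"
    using forest_below_girth[OF G gr A] by (intro card_matched_maps_forest[OF G perf A(1)]) auto
  ultimately have "card (matched_maps (verts G) L W A) * q ^ card A
      = q ^ (card (verts G) - card A) * q ^ card A"
    by (simp add: power_add[symmetric])
  then show ?thesis using q by simp
qed

text \<open>
  Both counts are expanded by inclusion--exclusion. Edge sets with at most \<open>r\<close> edges that are not
  cycles are forests, and their terms cancel. Each set with more than \<open>r\<close> edges contains a forest with
  \<open>r\<close> edges and contributes at most \<open>q ^ (n - r)\<close> in absolute value; there are at most \<open>2 ^ m\<close> such
  sets. Only the cycles of length \<open>r\<close> remain, and they carry the sign \<open>+1\<close> because \<open>r\<close> is even.
\<close>

lemma unmatched_maps_diff_estimate: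
  assumes G: "simple_graph G" and gr: "girth G = enat r" and r: "even r" "0 < r" and q: "0 < q"
    and p1: "perfect_on G q L1 W1" and p2: "perfect_on G q L2 W2"
  defines "n \<equiv> card (verts G)" and "m \<equiv> card (edges G)"
  shows "\<bar>int (card (unmatched_maps (verts G) L1 W1 (edges G)))
      - int (card (unmatched_maps (verts G) L2 W2 (edges G)))
      - (\<Sum>C\<in>cycles G r. int (card (matched_maps (verts G) L1 W1 (edges C)))
          - int (card (matched_maps (verts G) L2 W2 (edges C))))\<bar>
    \<le> 2 ^ m * int q ^ (n - r)"
proof -
  let ?V = "verts G" and ?E = "edges G"
  let ?N1 = "\<lambda>A. int (card (matched_maps ?V L1 W1 A))" and ?N2 = "\<lambda>A. int (card (matched_maps ?V L2 W2 A))"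
  let ?d = "\<lambda>A. (-1) ^ card A * (?N1 A - ?N2 A)"
  define Z where "Z = edges ` cycles G r"
  have finV: "finite ?V" using G by (simp add: simple_graph_def)
  have finE: "finite ?E" using G by (rule simple_graph_finite_edges)
  have ZE: "Z \<subseteq> Pow ?E" by (auto simp: Z_def cycles_def subgraph_def)
  have Zcard: "card A = r" if "A \<in> Z" for A
    using that is_cycle_card_edges(1) by (auto simp: Z_def cycles_def)
  have fl: "finite (L1 v)" "finite (L2 v)" if "v \<in> ?V" for v
    using p1 p2 that by (auto simp: perfect_on_def)
  have "int (card (unmatched_maps ?V L1 W1 ?E)) - int (card (unmatched_maps ?V L2 W2 ?E)) = (\<Sum>A\<in>Pow ?E. ?d A)"
    using card_unmatched_maps[OF finV fl(1) finE, where W = W1] card_unmatched_maps[OF finV fl(2) finE, where W = W2]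
    by (simp add: sum_subtractf right_diff_distrib)
  also have "\<dots> = (\<Sum>A\<in>Z. ?d A) + (\<Sum>A\<in>Pow ?E - Z. ?d A)"
    using ZE finE by (subst sum.subset_diff[of Z]) auto
  also have "(\<Sum>A\<in>Z. ?d A) = (\<Sum>A\<in>Z. ?N1 A - ?N2 A)"
    using Zcard r by (intro sum.cong) auto
  also have "\<dots> = (\<Sum>C\<in>cycles G r. ?N1 (edges C) - ?N2 (edges C))"
    unfolding Z_def by (simp add: sum.reindex[OF inj_on_edges_cycles])
  finally have eq: "int (card (unmatched_maps ?V L1 W1 ?E)) - int (card (unmatched_maps ?V L2 W2 ?E))
      - (\<Sum>C\<in>cycles G r. ?N1 (edges C) - ?N2 (edges C)) = (\<Sum>A\<in>Pow ?E - Z. ?d A)" by simp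
  have small: "\<bar>?d A\<bar> \<le> int q ^ (n - r)" if A: "A \<in> Pow ?E - Z" for A
  proof (cases "card A \<le> r")
    case True
    then have "?N1 A = ?N2 A"
      using A matched_maps_noncycle[OF G gr p1 q, of A] matched_maps_noncycle[OF G gr p2 q, of A]
      by (simp add: Z_def)
    then show ?thesis by simp
  next
    case False
    then obtain F where F: "F \<subseteq> A" "card F = r" "F \<notin> edges ` cycles G r"
      using ex_noncycle_subset[OF G _ _ r(2), of A] A by auto
    have FE: "F \<subseteq> ?E" using F A by auto
    have "card (matched_maps ?V L1 W1 A) \<le> q ^ (n - r)"
      using matched_maps_noncycle[OF G gr p1 q FE _ F(3)] F(2)
        card_mono[OF finite_matched_maps[OF G p1] matched_maps_antimono[OF F(1)]]
      by (simp add: n_def)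
    moreover have "card (matched_maps ?V L2 W2 A) \<le> q ^ (n - r)"
      using matched_maps_noncycle[OF G gr p2 q FE _ F(3)] F(2)
        card_mono[OF finite_matched_maps[OF G p2] matched_maps_antimono[OF F(1)]]
      by (simp add: n_def)
    ultimately have "?N1 A \<le> int q ^ (n - r)" "?N2 A \<le> int q ^ (n - r)"
      by (metis of_nat_le_iff of_nat_power)+
    then have "\<bar>?N1 A - ?N2 A\<bar> \<le> int q ^ (n - r)" by linarith
    then show ?thesis by (simp add: abs_mult power_abs)
  qed
  have "\<bar>\<Sum>A\<in>Pow ?E - Z. ?d A\<bar> \<le> (\<Sum>A\<in>Pow ?E - Z. \<bar>?d A\<bar>)" by (rule sum_abs)
  also have "\<dots> \<le> int (card (Pow ?E - Z)) * int q ^ (n - r)"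
    using small by (intro sum_bounded_above) auto
  also have "\<dots> \<le> int (card (Pow ?E)) * int q ^ (n - r)"
    using finE by (intro mult_right_mono of_nat_mono card_mono) auto
  also have "\<dots> = 2 ^ m * int q ^ (n - r)" using finE by (simp add: card_Pow m_def)
  finally show ?thesis unfolding eq .
qed

section \<open>Ordinary colourings\<close>

lemma chromatic_polynomial_unmatched:
  assumes G: "simple_graph G"
  shows "chromatic_polynomial G q =
    card (unmatched_maps (verts G) (\<lambda>_. {1..q}) (range (\<lambda>i. {i})) (edges G))"
proof -
  have "(\<forall>u v. {u, v} \<in> edges G \<longrightarrow> f u \<noteq> f v) \<longleftrightarrow> (\<forall>e\<in>edges G. f ` e \<notin> range (\<lambda>i. {i}))"
    for f :: "'a \<Rightarrow> nat"
  proof (intro iffI ballI allI impI)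
    fix e assume *: "\<forall>u v. {u, v} \<in> edges G \<longrightarrow> f u \<noteq> f v" "e \<in> edges G"
    then obtain u v where "e = {u, v}" using simple_graph_edgeE[OF G, of e] by blast
    moreover from this have "f u \<noteq> f v" using * by blast
    ultimately show "f ` e \<notin> range (\<lambda>i. {i})" by auto
  next
    fix u v assume "\<forall>e\<in>edges G. f ` e \<notin> range (\<lambda>i. {i})" "{u, v} \<in> edges G"
    then show "f u \<noteq> f v" by auto
  qed
  then show ?thesis
    by (simp add: chromatic_polynomial_def proper_colorings_def unmatched_maps_def)
qed

lemma perfect_on_equality: "perfect_on G q (\<lambda>_. {1..q}) (range (\<lambda>i. {i}))"
  unfolding perfect_on_def by (auto simp: singleton_insert_inj_eq)

text \<open>
  A map that is constant along all but one edge of a cycle is constant on the whole cycle, so the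
  last edge imposes no condition and the count is that of a path with \<open>r - 1\<close> edges.
\<close>

lemma card_matched_maps_equality_cycle:
  assumes G: "simple_graph G" and gr: "girth G = enat r" and q: "0 < q" and C: "C \<in> cycles G r"
  shows "card (matched_maps (verts G) (\<lambda>_. {1..q}) (range (\<lambda>i. {i})) (edges C))
    = q ^ (card (verts G) - r + 1)"
proof -
  let ?W = "range (\<lambda>i::nat. {i})"
  obtain vs where vs: "3 \<le> length vs" "length vs = r" "distinct vs" "verts C = set vs"
     "edges C = (\<lambda>i. {vs ! i, vs ! (Suc i mod length vs)}) ` {..<length vs}"
    using C by (auto simp: cycles_def elim: is_cycleE)
  have cE: "card (edges C) = r" "edges C \<subseteq> edges G"
    using C is_cycle_card_edges(1) by (auto simp: cycles_def subgraph_def)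
  define e where "e = {vs ! (r - 1), vs ! 0}"
  have eC: "e \<in> edges C" unfolding vs(5) by (rule image_eqI[of _ _ "r - 1"]) (use vs(1,2) in \<open>auto simp: e_def\<close>)
  have step: "{vs ! i, vs ! Suc i} \<in> edges C - {e}" if "Suc i < r" for i
  proof -
    have "{vs ! i, vs ! Suc i} \<in> edges C"
      unfolding vs(5) by (rule image_eqI[of _ _ i]) (use vs(2) that in auto)
    moreover have "{vs ! i, vs ! Suc i} \<noteq> e"
      using inj_onD[OF cyclic_edges_inj[OF vs(1,3)], of i "r - 1"] vs(1,2) that by (auto simp: e_def)
    ultimately show ?thesis by simp
  qed
  have "matched_maps (verts G) (\<lambda>_. {1..q}) ?W (edges C - {e}) \<subseteq> matched_maps (verts G) (\<lambda>_. {1..q}) ?W (edges C)"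
  proof
    fix f assume f: "f \<in> matched_maps (verts G) (\<lambda>_. {1..q}) ?W (edges C - {e})"
    have const: "f (vs ! i) = f (vs ! 0)" if "i < r" for i
      using that
    proof (induction i)
      case (Suc i)
      have "f ` {vs ! i, vs ! Suc i} \<in> ?W"
        using f step[OF Suc.prems] by (simp only: matched_maps_def mem_Collect_eq)
      then have "f (vs ! Suc i) = f (vs ! i)" by auto
      then show ?case using Suc.IH Suc.prems by simp
    qed simp
    have "f ` e = {f (vs ! 0)}" using const[of "r - 1"] vs(1,2) by (simp add: e_def)
    then show "f \<in> matched_maps (verts G) (\<lambda>_. {1..q}) ?W (edges C)"
      using f unfolding matched_maps_def by blast
  qed
  then have "matched_maps (verts G) (\<lambda>_. {1..q}) ?W (edges C) = matched_maps (verts G) (\<lambda>_. {1..q}) ?W (edges C - {e})"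
    using matched_maps_antimono[of "edges C - {e}" "edges C"] by (intro equalityI) blast+
  moreover have c: "card (edges C - {e}) = r - 1" using eC cE by simp
  moreover have "edges C - {e} \<notin> edges ` cycles G r"
    using c vs(1,2) is_cycle_card_edges(1) by (fastforce simp: cycles_def)
  ultimately have "card (matched_maps (verts G) (\<lambda>_. {1..q}) ?W (edges C)) = q ^ (card (verts G) - (r - 1))"
    using matched_maps_noncycle[OF G gr perfect_on_equality q, of "edges C - {e}"] cE by auto
  moreover have "card (verts G) - (r - 1) = card (verts G) - r + 1"
    using cycles_card_le[OF G C] vs(1,2) by linarith
  ultimately show ?thesis by (simp only:)
qed

section \<open>Arbitrary covers\<close>

text \<open>
  A proper colouring of a cover is the image of the map that sends \<open>v\<close> to its unique element in
  \<open>L v\<close>; disjointness of the lists makes the map recoverable from its image.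
\<close>

lemma cover_count_eq_unmatched:
  assumes G: "simple_graph G" and cov: "is_cover G L H"
  shows "cover_count G L H = card (unmatched_maps (verts G) L (edges H) (edges G))"
proof -
  let ?V = "verts G"
  have HV: "verts H = (\<Union>v\<in>?V. L v)" and H: "simple_graph H"
    and disj: "\<And>u v. u \<in> ?V \<Longrightarrow> v \<in> ?V \<Longrightarrow> u \<noteq> v \<Longrightarrow> L u \<inter> L v = {}"
    and between: "\<And>u v. u \<in> ?V \<Longrightarrow> v \<in> ?V \<Longrightarrow> u \<noteq> v \<Longrightarrow> {u, v} \<notin> edges G \<Longrightarrow> edges_between H (L u) (L v) = {}"
    using cov unfolding is_cover_def disjoint_family_on_def by blast+
  have image_Int: "f ` ?V \<inter> L v = {f v}" if "f \<in> PiE ?V L" "v \<in> ?V" for f v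
  proof -
    have "f u \<in> L u" if "u \<in> ?V" for u using \<open>f \<in> PiE ?V L\<close> that by auto
    then show ?thesis using disj that(2) by blast
  qed
  have indep: "independent_in H (f ` ?V) \<longleftrightarrow> (\<forall>e\<in>edges G. f ` e \<notin> edges H)" if f: "f \<in> PiE ?V L" for f
  proof
    assume ind: "independent_in H (f ` ?V)"
    show "\<forall>e\<in>edges G. f ` e \<notin> edges H"
    proof
      fix e assume "e \<in> edges G"
      then obtain u v where "e = {u, v}" "u \<in> ?V" "v \<in> ?V" using simple_graph_edgeE[OF G, of e] by blast
      then show "f ` e \<notin> edges H" using ind by (auto simp: independent_in_def)
    qed
  next
    assume *: "\<forall>e\<in>edges G. f ` e \<notin> edges H"
    have "{f u, f v} \<notin> edges H" if uv: "u \<in> ?V" "v \<in> ?V" for u v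
    proof
      assume edge: "{f u, f v} \<in> edges H"
      then have "card {f u, f v} = 2" using H by (auto simp: simple_graph_def)
      then have "u \<noteq> v" by auto
      have "{f u, f v} \<in> edges_between H (L u) (L v)"
        using edge f uv by (auto simp: edges_between_def)
      then have "{u, v} \<in> edges G" using between uv \<open>u \<noteq> v\<close> by blast
      then show False using * edge by auto
    qed
    moreover have "f ` ?V \<subseteq> verts H" using f HV by auto
    ultimately show "independent_in H (f ` ?V)" by (auto simp: independent_in_def)
  qed
  have "bij_betw (\<lambda>f. f ` ?V) (unmatched_maps ?V L (edges H) (edges G)) (cover_colorings G L H)"
    unfolding bij_betw_def
  proof (intro conjI inj_onI equalityI subsetI)
    fix f h assume fh: "f \<in> unmatched_maps ?V L (edges H) (edges G)"
      "h \<in> unmatched_maps ?V L (edges H) (edges G)" "f ` ?V = h ` ?V"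
    then have P: "f \<in> PiE ?V L" "h \<in> PiE ?V L" by (auto simp: unmatched_maps_def)
    show "f = h"
    proof (rule PiE_ext[OF P])
      fix v assume v: "v \<in> ?V"
      show "f v = h v" using image_Int[OF P(1) v] image_Int[OF P(2) v] fh(3) by simp
    qed
  next
    fix T assume "T \<in> (\<lambda>f. f ` ?V) ` unmatched_maps ?V L (edges H) (edges G)"
    then obtain f where f: "f \<in> PiE ?V L" "\<forall>e\<in>edges G. f ` e \<notin> edges H" "T = f ` ?V"
      by (auto simp: unmatched_maps_def)
    then show "T \<in> cover_colorings G L H"
      using image_Int[OF f(1)] indep[OF f(1)] by (auto simp: cover_colorings_def independent_in_def)
  next
    fix T assume T: "T \<in> cover_colorings G L H"
    define f where "f = (\<lambda>v\<in>?V. the_elem (T \<inter> L v))"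
    have fv: "T \<inter> L v = {f v}" if "v \<in> ?V" for v
    proof -
      have "card (T \<inter> L v) = 1" using T that by (auto simp: cover_colorings_def)
      then obtain x where "T \<inter> L v = {x}" by (rule card_1_singletonE)
      then show ?thesis using that by (simp add: f_def)
    qed
    have "f v \<in> L v" if "v \<in> ?V" for v using fv[OF that] by blast
    then have fP: "f \<in> PiE ?V L" by (intro PiE_I) (simp_all add: f_def)
    have "T \<subseteq> (\<Union>v\<in>?V. L v)" using T HV by (auto simp: cover_colorings_def)
    then have TV: "T = f ` ?V" using fv by blast
    have "independent_in H (f ` ?V)" using T TV by (simp add: cover_colorings_def)
    then have "f \<in> unmatched_maps ?V L (edges H) (edges G)"
      using indep[OF fP] fP by (simp add: unmatched_maps_def)
    then show "T \<in> (\<lambda>f. f ` ?V) ` unmatched_maps ?V L (edges H) (edges G)" using TV by blast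
  qed
  then show ?thesis unfolding cover_count_def by (metis bij_betw_same_card)
qed

text \<open>
  The matching is an injection from a subset of \<open>X\<close> into \<open>Y\<close>, and the two unmatched remainders have
  the same size.
\<close>

lemma ex_bij_extending_matching:
  assumes fin: "finite X" "finite Y" "card X = card Y" and disj: "X \<inter> Y = {}"
    and mat: "matching (edges_between H X Y)"
  obtains h where "bij_betw h X Y" "\<And>x y. x \<in> X \<Longrightarrow> y \<in> Y \<Longrightarrow> {x, y} \<in> edges H \<Longrightarrow> y = h x"
proof -
  have same: "{x, y} = {x', y'}" if "x \<in> X" "y \<in> Y" "{x, y} \<in> edges H" "x' \<in> X" "y' \<in> Y" "{x', y'} \<in> edges H"
     "x = x' \<or> y = y'" for x y x' y'
  proof -
    have mem: "{x, y} \<in> edges_between H X Y" "{x', y'} \<in> edges_between H X Y"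
      using that(1-6) unfolding edges_between_def by blast+
    show ?thesis
    proof (rule ccontr)
      assume "{x, y} \<noteq> {x', y'}"
      then have "disjnt {x, y} {x', y'}" using pairwiseD[OF mat[unfolded matching_def] mem] by blast
      then show False using that(7) by (auto simp: disjnt_def)
    qed
  qed
  define D where "D = {x \<in> X. \<exists>y\<in>Y. {x, y} \<in> edges H}"
  have "\<forall>x\<in>D. \<exists>y. y \<in> Y \<and> {x, y} \<in> edges H" by (auto simp: D_def)
  then obtain p where p: "\<And>x. x \<in> D \<Longrightarrow> p x \<in> Y \<and> {x, p x} \<in> edges H" by metis
  have p_eq: "y = p x" if "x \<in> X" "y \<in> Y" "{x, y} \<in> edges H" for x y
  proof -
    have "x \<in> D" using that by (auto simp: D_def)
    then show ?thesis using same[of x y x "p x"] p[of x] that by (auto simp: doubleton_eq_iff)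
  qed
  have inj: "inj_on p D"
  proof (rule inj_onI)
    fix x x' assume x: "x \<in> D" "x' \<in> D" "p x = p x'"
    then have "x \<in> X" "x' \<in> X" by (auto simp: D_def)
    then show "x = x'" using same[of x "p x" x' "p x'"] p[of x] p[of x'] x disj
      by (auto simp: doubleton_eq_iff)
  qed
  have sub: "D \<subseteq> X" "p ` D \<subseteq> Y" using p by (auto simp: D_def)
  then have "card (X - D) = card (Y - p ` D)"
    using fin inj by (simp add: card_Diff_subset finite_subset card_image)
  then obtain r where r: "bij_betw r (X - D) (Y - p ` D)"
    using finite_same_card_bij[of "X - D" "Y - p ` D"] fin by auto
  define h where "h x = (if x \<in> D then p x else r x)" for x
  have "bij_betw h D (p ` D)" using inj by (simp add: bij_betw_def h_def inj_on_def)
  moreover have "bij_betw h (X - D) (Y - p ` D)"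
    using r by (rule bij_betw_cong[THEN iffD1, rotated]) (simp add: h_def)
  ultimately have "bij_betw h (D \<union> (X - D)) (p ` D \<union> (Y - p ` D))"
    by (rule bij_betw_combine) auto
  moreover have "D \<union> (X - D) = X" "p ` D \<union> (Y - p ` D) = Y" using sub by auto
  ultimately have "bij_betw h X Y" by simp
  moreover have "y = h x" if "x \<in> X" "y \<in> Y" "{x, y} \<in> edges H" for x y
  proof -
    have "x \<in> D" using that by (auto simp: D_def)
    then show ?thesis using p_eq[OF that] by (simp add: h_def)
  qed
  ultimately show thesis using that by blast
qed

text \<open>
  Enlarging every matching to a perfect one only forbids more maps. Hence it suffices to bound
  the number of colourings from below for perfect matchings.
\<close>

lemma ex_perfect_extension:
  assumes G: "simple_graph G" and cov: "is_fold_cover q G L H"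
  obtains W where "perfect_on G q L W"
    "unmatched_maps (verts G) L W (edges G) \<subseteq> unmatched_maps (verts G) L (edges H) (edges G)"
proof -
  let ?V = "verts G"
  have HV: "verts H = (\<Union>v\<in>?V. L v)" and "finite (verts H)"
    and disj: "\<And>u v. u \<in> ?V \<Longrightarrow> v \<in> ?V \<Longrightarrow> u \<noteq> v \<Longrightarrow> L u \<inter> L v = {}"
    and mat: "\<And>u v. u \<in> ?V \<Longrightarrow> v \<in> ?V \<Longrightarrow> u \<noteq> v \<Longrightarrow> matching (edges_between H (L u) (L v))"
    and cq: "\<And>v. v \<in> ?V \<Longrightarrow> card (L v) = q"
    using cov unfolding is_fold_cover_def is_cover_def disjoint_family_on_def simple_graph_def by blast+
  then have fin: "finite (L v)" if "v \<in> ?V" for v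
    using that by (metis UN_upper finite_subset)
  have "\<exists>a b h. e = {a, b} \<and> a \<noteq> b \<and> a \<in> ?V \<and> b \<in> ?V \<and> bij_betw h (L a) (L b)
      \<and> (\<forall>x\<in>L a. \<forall>y\<in>L b. {x, y} \<in> edges H \<longrightarrow> y = h x)" if e: "e \<in> edges G" for e
  proof -
    obtain a b where ab: "e = {a, b}" "a \<noteq> b" "a \<in> ?V" "b \<in> ?V"
      using simple_graph_edgeE[OF G e] .
    obtain h where "bij_betw h (L a) (L b)"
      "\<And>x y. x \<in> L a \<Longrightarrow> y \<in> L b \<Longrightarrow> {x, y} \<in> edges H \<Longrightarrow> y = h x"
      using ex_bij_extending_matching[of "L a" "L b" H] ab fin cq disj mat by metis
    then show ?thesis using ab by blast
  qed
  then obtain a b h where ab: "\<And>e. e \<in> edges G \<Longrightarrow> e = {a e, b e} \<and> a e \<noteq> b e \<and> a e \<in> ?V \<and> b e \<in> ?V"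
    and h: "\<And>e. e \<in> edges G \<Longrightarrow> bij_betw (h e) (L (a e)) (L (b e))"
    and ext: "\<And>e x y. e \<in> edges G \<Longrightarrow> x \<in> L (a e) \<Longrightarrow> y \<in> L (b e) \<Longrightarrow> {x, y} \<in> edges H \<Longrightarrow> y = h e x"
    by metis
  have ab_eq: "e = {a e, b e}" and ab_ne: "a e \<noteq> b e" and abV: "a e \<in> ?V" "b e \<in> ?V"
    if "e \<in> edges G" for e
    using ab[OF that] by blast+
  \<comment> \<open>Each edge \<open>e\<close> is given an arbitrary orientation from \<open>a e\<close> to \<open>b e\<close>, along which \<open>h e\<close> is the
    bijection; \<open>W\<close> itself is unoriented.\<close>
  define W where "W = {{x, h e x} | e x. e \<in> edges G \<and> x \<in> L (a e)}"
  have memW: "{x, y} \<in> W \<longleftrightarrow> y = h e x" if e: "e \<in> edges G" and xy: "x \<in> L (a e)" "y \<in> L (b e)" for e x y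
  proof
    assume "{x, y} \<in> W"
    then obtain e' x' where e': "e' \<in> edges G" "x' \<in> L (a e')" "{x, y} = {x', h e' x'}" by (auto simp: W_def)
    have hx': "h e' x' \<in> L (b e')" using h[OF e'(1)] e'(2) by (auto dest: bij_betwE)
    have same: "u = v" if "z \<in> L u" "z \<in> L v" "u \<in> ?V" "v \<in> ?V" for u v z using disj that by blast
    note V = abV[OF e] abV[OF e'(1)]
    from e'(3) consider "x = x'" "y = h e' x'" | "x = h e' x'" "y = x'" by (auto simp: doubleton_eq_iff)
    then show "y = h e x"
    proof cases
      case 1
      then have "a e = a e'" "b e = b e'"
        using same[OF xy(1) _ V(1,3)] same[OF xy(2) _ V(2,4)] e'(2) hx' by simp_all
      then have "{a e, b e} = {a e', b e'}" by simp
      then have "e = e'" by (rule box_equals[OF _ ab_eq[OF e, symmetric] ab_eq[OF e'(1), symmetric]])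
      then show ?thesis using 1 by simp
    next
      case 2
      then have sw: "a e = b e'" "b e = a e'"
        using same[OF xy(1) _ V(1,4)] same[OF xy(2) _ V(2,3)] e'(2) hx' by simp_all
      then have "{a e, b e} = {a e', b e'}" by (simp add: insert_commute)
      then have "e = e'" by (rule box_equals[OF _ ab_eq[OF e, symmetric] ab_eq[OF e'(1), symmetric]])
      then show ?thesis using sw ab_ne[OF e] by simp
    qed
  next
    assume "y = h e x"
    then show "{x, y} \<in> W" using e xy by (auto simp: W_def)
  qed
  have "perfect_on G q L W"
    unfolding perfect_on_def
  proof (intro conjI ballI allI impI)
    fix v assume "v \<in> ?V" then show "finite (L v)" "card (L v) = q" using fin cq by auto
  next
    fix u v x assume e: "{u, v} \<in> edges G" and x: "x \<in> L u"
    let ?e = "{u, v}"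
    have bij: "\<exists>!x. x \<in> L (a ?e) \<and> y = h ?e x" if "y \<in> L (b ?e)" for y
      using h[OF e] that unfolding bij_betw_def inj_on_def by blast
    have hL: "h ?e x \<in> L (b ?e)" if "x \<in> L (a ?e)" for x using h[OF e] that by (auto dest: bij_betwE)
    from ab_eq[OF e] consider "u = a ?e" "v = b ?e" | "u = b ?e" "v = a ?e"
      unfolding doubleton_eq_iff by blast
    then show "\<exists>!y. y \<in> L v \<and> {x, y} \<in> W"
    proof cases
      case 1
      then have "x \<in> L (a ?e)" "\<And>y. y \<in> L v \<Longrightarrow> y \<in> L (b ?e)" using x by auto
      then have "y \<in> L v \<and> {x, y} \<in> W \<longleftrightarrow> y = h ?e x" for y
        using memW[OF e, of x y] hL[of x] 1(2) by metis
      then show ?thesis by simp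
    next
      case 2
      then have "x \<in> L (b ?e)" using x by simp
      then have "y \<in> L v \<and> {x, y} \<in> W \<longleftrightarrow> y \<in> L (a ?e) \<and> x = h ?e y" for y
        using memW[OF e, of y x] 2(2) by (metis insert_commute)
      then show ?thesis using bij[OF \<open>x \<in> L (b ?e)\<close>] by simp
    qed
  qed
  moreover have "unmatched_maps ?V L W (edges G) \<subseteq> unmatched_maps ?V L (edges H) (edges G)"
  proof
    fix f assume f: "f \<in> unmatched_maps ?V L W (edges G)"
    have "f ` e \<notin> edges H" if e: "e \<in> edges G" for e
    proof
      assume *: "f ` e \<in> edges H"
      have fL: "f (a e) \<in> L (a e)" "f (b e) \<in> L (b e)" using f abV[OF e] by (auto simp: unmatched_maps_def)
      have fe: "f ` e = {f (a e), f (b e)}" by (subst ab_eq[OF e]) simp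
      then have "f ` e \<in> W" using ext[OF e fL] memW[OF e fL] * by simp
      then show False using f e by (auto simp: unmatched_maps_def)
    qed
    then show "f \<in> unmatched_maps ?V L (edges H) (edges G)" using f by (auto simp: unmatched_maps_def)
  qed
  ultimately show thesis using that by blast
qed

section \<open>Sum covers and even cycles\<close>

text \<open>
  Two colours over an edge are forbidden together when they sum to a prescribed residue. The
  condition is symmetric in the two ends, so that, unlike for a cover given by cyclic shifts, the
  edges need no orientation.
\<close>

definition sum_cover_edges :: "'a ugraph \<Rightarrow> nat \<Rightarrow> ('a set \<Rightarrow> nat) \<Rightarrow> ('a \<times> nat) set set" where
  "sum_cover_edges G q c = {{(u, i), (v, j)} | u v i j.
     {u, v} \<in> edges G \<and> i < q \<and> j < q \<and> [i + j = c {u, v}] (mod q)}"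

lemma sum_cover_edges_iff:
  "{(u, i), (v, j)} \<in> sum_cover_edges G q c \<longleftrightarrow>
     {u, v} \<in> edges G \<and> i < q \<and> j < q \<and> [i + j = c {u, v}] (mod q)"
  unfolding sum_cover_edges_def by (auto simp: doubleton_eq_iff insert_commute add.commute)

lemma sum_cover_perfect:
  assumes G: "simple_graph G" and q: "0 < q"
  shows "perfect_on G q (\<lambda>v. {v} \<times> {..<q}) (sum_cover_edges G q c)"
proof -
  have "\<exists>!y. y \<in> {v} \<times> {..<q} \<and> {x, y} \<in> sum_cover_edges G q c"
    if e: "{u, v} \<in> edges G" and x: "x \<in> {u} \<times> {..<q}" for u v x
  proof -
    obtain i where i: "x = (u, i)" "i < q" using x by auto
    define j where "j = (c {u, v} + (q - i)) mod q"
    have j: "[i + j = c {u, v}] (mod q)" "j < q"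
      using i q by (auto simp: j_def cong_def mod_add_right_eq)
    have j_unique: "j' = j" if "[i + j' = c {u, v}] (mod q)" "j' < q" for j'
    proof -
      have "[i + j' = i + j] (mod q)" using cong_trans[OF that(1) cong_sym[OF j(1)]] .
      then show ?thesis using that(2) j(2) by (simp add: cong_add_lcancel_nat cong_less_modulus_unique_nat)
    qed
    show ?thesis
    proof (rule ex1I[of _ "(v, j)"])
      show "(v, j) \<in> {v} \<times> {..<q} \<and> {x, (v, j)} \<in> sum_cover_edges G q c"
        using e i j by (simp add: sum_cover_edges_iff)
      fix y assume y: "y \<in> {v} \<times> {..<q} \<and> {x, y} \<in> sum_cover_edges G q c"
      then obtain j' where j': "y = (v, j')" "j' < q" by blast
      then show "y = (v, j)" using j_unique[of j'] y i(1) by (simp add: sum_cover_edges_iff)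
    qed
  qed
  then show ?thesis by (auto simp: perfect_on_def card_cartesian_product)
qed

lemma sum_cover_is_fold_cover:
  assumes G: "simple_graph G" and q: "0 < q"
  shows "is_fold_cover q G (\<lambda>v. {v} \<times> {..<q}) \<lparr>verts = verts G \<times> {..<q}, edges = sum_cover_edges G q c\<rparr>"
    (is "is_fold_cover q G ?L ?H")
  unfolding is_fold_cover_def is_cover_def
proof (intro conjI ballI impI)
  have ne: "u \<noteq> v" "u \<in> verts G" "v \<in> verts G" if "{u, v} \<in> edges G" for u v
    using G that by (auto simp: simple_graph_def card_2_iff doubleton_eq_iff)
  show "simple_graph ?H"
    unfolding simple_graph_def
  proof (intro conjI ballI)
    show "finite (verts ?H)" "verts ?H \<noteq> {}" using G q by (auto simp: simple_graph_def)
    fix e assume "e \<in> edges ?H"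
    then obtain u v i j where "e = {(u, i), (v, j)}" "{u, v} \<in> edges G" "i < q" "j < q"
      by (auto simp: sum_cover_edges_def)
    then show "e \<subseteq> verts ?H" "card e = 2" using ne[of u v] by auto
  qed
  show "disjoint_family_on ?L (verts G)" by (auto simp: disjoint_family_on_def)
  show "independent_in ?H (?L v)" if "v \<in> verts G" for v
    using that ne[of v v] by (auto simp: independent_in_def sum_cover_edges_iff)
  show "verts ?H = (\<Union>v\<in>verts G. ?L v)" by auto
  show "card (?L v) = q" for v :: 'a by (simp add: card_cartesian_product)
  fix u v assume uv: "u \<in> verts G" "v \<in> verts G" "u \<noteq> v"
  show "edges_between ?H (?L u) (?L v) = {}" if "{u, v} \<notin> edges G"
    using that by (auto simp: edges_between_def sum_cover_edges_iff)
  have uniq: "\<exists>!y. y \<in> ?L b \<and> {x, y} \<in> sum_cover_edges G q c" if "{a, b} \<in> edges G" "x \<in> ?L a" for a b x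
    using perfect_onD[OF sum_cover_perfect[OF G q] that] .
  have mate_unique: "y = y'" if "{a, b} \<in> edges G" "x \<in> ?L a" "y \<in> ?L b" "y' \<in> ?L b"
    "{x, y} \<in> sum_cover_edges G q c" "{x, y'} \<in> sum_cover_edges G q c" for a b x y y'
    using uniq[OF that(1,2)] that(3-6) by blast
  show "matching (edges_between ?H (?L u) (?L v))"
    unfolding matching_def
  proof (rule pairwiseI)
    fix d d' assume d: "d \<in> edges_between ?H (?L u) (?L v)" "d' \<in> edges_between ?H (?L u) (?L v)" "d \<noteq> d'"
    from d(1) obtain i j where ij: "d = {(u, i), (v, j)}" "i < q" "j < q" "d \<in> sum_cover_edges G q c"
      unfolding edges_between_def ugraph.simps by blast
    from d(2) obtain i' j' where ij': "d' = {(u, i'), (v, j')}" "i' < q" "j' < q" "d' \<in> sum_cover_edges G q c"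
      unfolding edges_between_def ugraph.simps by blast
    have e: "{u, v} \<in> edges G" "{v, u} \<in> edges G"
      using ij(1,4) by (simp_all add: sum_cover_edges_iff insert_commute)
    have "i \<noteq> i'"
      using mate_unique[OF e(1), of "(u, i)" "(v, j)" "(v, j')"] ij ij' d(3) by auto
    moreover have "j \<noteq> j'"
      using mate_unique[OF e(2), of "(v, j)" "(u, i)" "(u, i')"] ij ij' d(3) by (auto simp: insert_commute)
    ultimately show "disjnt d d'" using ij(1) ij'(1) uv(3) by (auto simp: disjnt_def)
  qed
qed

text \<open>
  With \<open>j\<close> the index of the smallest exponent, all other terms are divisible by twice the power of two
  in the term of \<open>j\<close>, but that term is not.
\<close>

lemma signed_powers_of_two_nonzero:
  fixes s :: "'i \<Rightarrow> int"
  assumes I: "finite I" "I \<noteq> {}" and inj: "inj_on b I" and odd: "\<And>i. i \<in> I \<Longrightarrow> odd (s i)"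
  shows "(\<Sum>i\<in>I. s i * 2 ^ b i) \<noteq> 0"
proof
  assume zero: "(\<Sum>i\<in>I. s i * 2 ^ b i) = 0"
  define j where "j = arg_min_on b I"
  have j: "j \<in> I" "\<forall>i\<in>I. b j \<le> b i"
    using arg_min_if_finite(1)[OF I, of b] arg_min_least[OF I, of _ b] by (simp_all add: j_def)
  have "(2::int) ^ Suc (b j) dvd (\<Sum>i\<in>I - {j}. s i * 2 ^ b i)"
  proof (rule dvd_sum)
    fix i assume i: "i \<in> I - {j}"
    then have "b i \<noteq> b j" using inj j by (auto simp: inj_on_def)
    then have "Suc (b j) \<le> b i" using j(2) i by force
    then show "(2::int) ^ Suc (b j) dvd s i * 2 ^ b i" by (intro dvd_mult le_imp_power_dvd)
  qed
  moreover have "(\<Sum>i\<in>I - {j}. s i * 2 ^ b i) = - (s j * 2 ^ b j)"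
    using zero I(1) j(1) by (simp add: sum.remove)
  ultimately have "(2::int) * 2 ^ b j dvd s j * 2 ^ b j" by simp
  then have "2 dvd s j" by simp
  then show False using odd j by blast
qed

text \<open>
  Along an even cycle, the alternating sum of the colour sums of the edges vanishes. If every edge is
  matched, the alternating sum of the prescribed values is therefore divisible by \<open>q\<close>. For distinct
  powers of two it is nonzero, and it is smaller than \<open>q\<close> in absolute value once \<open>q\<close> is large.
\<close>

lemma sum_cover_even_cycle:
  assumes C: "C \<in> cycles G k" and k: "even k" and inj: "inj_on b (edges G)" and fin: "finite (edges G)"
    and q: "(\<Sum>e\<in>edges G. 2 ^ b e) < q"
  shows "matched_maps (verts G) (\<lambda>v. {v} \<times> {..<q}) (sum_cover_edges G q (\<lambda>e. 2 ^ b e)) (edges C) = {}"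
proof (rule ccontr)
  let ?W = "sum_cover_edges G q (\<lambda>e. 2 ^ b e)"
  assume "\<not> ?thesis"
  then obtain f where f: "f \<in> matched_maps (verts G) (\<lambda>v. {v} \<times> {..<q}) ?W (edges C)" by blast
  obtain vs where vs: "3 \<le> length vs" "length vs = k" "distinct vs" "verts C = set vs"
     "edges C = (\<lambda>i. {vs ! i, vs ! (Suc i mod length vs)}) ` {..<length vs}"
    using C by (auto simp: cycles_def elim: is_cycleE)
  have sub: "verts C \<subseteq> verts G" "edges C \<subseteq> edges G" using C by (auto simp: cycles_def subgraph_def)
  define d where "d i = {vs ! i, vs ! (Suc i mod k)}" for i
  have injd: "inj_on d {..<k}" using cyclic_edges_inj[OF vs(1,3)] vs(2) by (simp add: d_def[abs_def])
  have dG: "d i \<in> edges G" "d i \<in> edges C" if "i < k" for i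
    using that sub(2) vs(2,5) by (auto simp: d_def)
  \<comment> \<open>The index is reduced modulo \<open>k\<close> so that \<open>F k = F 0\<close> and the alternating sum telescopes.\<close>
  define F where "F i = int (snd (f (vs ! (i mod k))))" for i
  have fv: "f v = (v, snd (f v))" if "v \<in> verts G" for v
    using f that by (auto simp: matched_maps_def dest!: PiE_mem)
  have lt: "i mod k < k" for i using vs(1,2) by (intro mod_less_divisor) linarith
  have cong: "int q dvd F i + F (Suc i) - 2 ^ b (d i)" if i: "i < k" for i
  proof -
    have "vs ! i \<in> verts G" "vs ! (Suc i mod k) \<in> verts G"
      using nth_mem[of _ vs] i lt[of "Suc i"] vs(2,4) sub(1) by blast+
    then have "f ` d i = {(vs ! i, snd (f (vs ! i))), (vs ! (Suc i mod k), snd (f (vs ! (Suc i mod k))))}"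
      using fv unfolding d_def by (metis image_empty image_insert)
    moreover have "f ` d i \<in> ?W" using f dG(2)[OF i] by (auto simp: matched_maps_def)
    ultimately have "[snd (f (vs ! i)) + snd (f (vs ! (Suc i mod k))) = 2 ^ b (d i)] (mod q)"
      by (simp add: sum_cover_edges_iff d_def)
    then have "[int (snd (f (vs ! i)) + snd (f (vs ! (Suc i mod k)))) = int (2 ^ b (d i))] (mod int q)"
      by (simp only: cong_int_iff)
    then show ?thesis using i by (simp add: F_def cong_iff_dvd_diff)
  qed
  let ?S = "\<Sum>i<k. (-1) ^ i * (2::int) ^ b (d i)"
  have tel: "(\<Sum>i<k. (-1) ^ i * (F i + F (Suc i))) = 0"
  proof -
    have "(\<Sum>i<k. (-1) ^ i * (F i + F (Suc i))) = (\<Sum>i<k. (-1) ^ i * F i - (-1) ^ Suc i * F (Suc i))"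
      by (simp add: algebra_simps)
    also have "\<dots> = (-1) ^ 0 * F 0 - (-1) ^ k * F k" by (rule sum_lessThan_telescope')
    also have "\<dots> = 0" using k by (simp add: F_def)
    finally show ?thesis .
  qed
  have "int q dvd (\<Sum>i<k. (-1) ^ i * (F i + F (Suc i) - 2 ^ b (d i)))"
    using cong by (intro dvd_sum dvd_mult) auto
  also have "\<dots> = (\<Sum>i<k. (-1) ^ i * (F i + F (Suc i))) - ?S"
    by (simp add: right_diff_distrib sum_subtractf)
  finally have dvd: "int q dvd ?S" using tel by simp
  have small: "\<bar>?S\<bar> < int q"
  proof -
    have "\<bar>?S\<bar> \<le> (\<Sum>i<k. \<bar>(-1) ^ i * (2::int) ^ b (d i)\<bar>)" by (rule sum_abs)
    also have "\<dots> = (\<Sum>i<k. 2 ^ b (d i))" by (simp add: abs_mult power_abs)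
    also have "\<dots> = (\<Sum>e\<in>d ` {..<k}. 2 ^ b e)" using injd by (simp add: sum.reindex)
    also have "\<dots> \<le> (\<Sum>e\<in>edges G. 2 ^ b e)" using fin dG by (intro sum_mono2) auto
    also have "\<dots> = int (\<Sum>e\<in>edges G. 2 ^ b e)" by simp
    also have "\<dots> < int q" using q by (simp only: of_nat_less_iff)
    finally show ?thesis .
  qed
  have "?S = 0"
  proof (rule ccontr)
    assume "?S \<noteq> 0"
    from dvd_imp_le_int[OF this dvd] show False using small by simp
  qed
  moreover have "?S \<noteq> 0"
  proof (rule signed_powers_of_two_nonzero)
    have "d ` {..<k} \<subseteq> edges G" using dG(1) by blast
    from comp_inj_on[OF injd inj_on_subset[OF inj this]]
    show "inj_on (\<lambda>i. b (d i)) {..<k}" by (simp add: comp_def)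
    show "{..<k} \<noteq> {}" using vs(1,2) by (auto simp: lessThan_empty_iff)
  qed auto
  ultimately show False by simp
qed

section \<open>The asymptotic difference\<close>

theorem theorem6:
  fixes G :: "'a ugraph" and g n m t :: nat
  assumes "odd g" and "g \<ge> 3"
    and "simple_graph G"
    and "card (verts G) = n"
    and "card (edges G) = m"
    and "girth G = enat (g + 1)"
    and "t = card (cycles G (g + 1))"
  shows "(\<lambda>q :: nat. real (chromatic_polynomial G q) - real (dp_color_function G q)
            - real t * real q ^ (n - g)) \<in> O(\<lambda>q. real q ^ (n - g - 1))"
proof -
  let ?V = "verts G" and ?E = "edges G" and ?r = "g + 1"
  note G = assms(3) and gr = assms(6)
  have finE: "finite ?E" by (rule simple_graph_finite_edges[OF G])
  obtain b :: "'a set \<Rightarrow> nat" where b: "inj_on b ?E" using finite_imp_inj_to_nat_seg[OF finE] by blast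
  obtain C0 where "C0 \<in> cycles G ?r" using girth_attained[OF gr] by blast
  then have gn: "g + 1 \<le> n" using cycles_card_le[OF G] assms(4) by blast
  have bound: "\<bar>int (chromatic_polynomial G q) - int (dp_color_function G q) - int t * int q ^ (n - g)\<bar>
      \<le> 2 ^ m * int q ^ (n - g - 1)" if q: "(\<Sum>e\<in>?E. 2 ^ b e) < q" for q
  proof -
    have q0: "0 < q" using q by simp
    let ?Wc = "range (\<lambda>i::nat. {i})"
    have Nc: "int (card (matched_maps ?V (\<lambda>_. {1..q}) ?Wc (edges C))) = int q ^ (n - g)" if "C \<in> cycles G ?r" for C
      using card_matched_maps_equality_cycle[OF G gr q0 that] gn assms(4) by (simp add: Suc_diff_Suc)
    have est: "\<bar>int (chromatic_polynomial G q) - int (card (unmatched_maps ?V L W ?E))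
        - (\<Sum>C\<in>cycles G ?r. int q ^ (n - g) - int (card (matched_maps ?V L W (edges C))))\<bar>
        \<le> 2 ^ m * int q ^ (n - g - 1)" if "perfect_on G q L W" for L :: "'a \<Rightarrow> 'c set" and W
    proof -
      have "(\<Sum>C\<in>cycles G ?r. int (card (matched_maps ?V (\<lambda>_. {1..q}) ?Wc (edges C)))
            - int (card (matched_maps ?V L W (edges C))))
          = (\<Sum>C\<in>cycles G ?r. int q ^ (n - g) - int (card (matched_maps ?V L W (edges C))))"
        by (intro sum.cong refl) (simp only: Nc)
      then show ?thesis
        using unmatched_maps_diff_estimate[OF G gr _ _ q0 perfect_on_equality that] assms(1,4,5)
          chromatic_polynomial_unmatched[OF G, of q] by simp
    qed
    \<comment> \<open>Upper bound: pass from an optimal cover to perfect matchings, and drop the nonnegative counts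
      on the cycles.\<close>
    obtain L :: "'a \<Rightarrow> nat set" and H where LH: "is_fold_cover q G L H" "cover_count G L H = dp_color_function G q"
      using dp_color_function_attained[OF G, of q] q0 by auto
    obtain W where W: "perfect_on G q L W" "unmatched_maps ?V L W ?E \<subseteq> unmatched_maps ?V L (edges H) ?E"
      using ex_perfect_extension[OF G LH(1)] .
    have cov: "is_cover G L H" using LH(1) by (simp add: is_fold_cover_def)
    have "finite (PiE ?V L)"
      using W(1) G by (intro finite_PiE) (auto simp: simple_graph_def perfect_on_def)
    then have "finite (unmatched_maps ?V L (edges H) ?E)" by (simp add: unmatched_maps_def)
    then have "card (unmatched_maps ?V L W ?E) \<le> dp_color_function G q"
      using card_mono[OF _ W(2)] LH(2) cover_count_eq_unmatched[OF G cov] by simp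
    moreover have "(\<Sum>C\<in>cycles G ?r. int q ^ (n - g) - int (card (matched_maps ?V L W (edges C))))
        \<le> (\<Sum>C\<in>cycles G ?r. int q ^ (n - g))" by (intro sum_mono) simp
    ultimately have upper: "int (chromatic_polynomial G q) - int (dp_color_function G q) - int t * int q ^ (n - g)
        \<le> 2 ^ m * int q ^ (n - g - 1)"
      using est[OF W(1)] assms(7) by simp
    \<comment> \<open>Lower bound: in the sum cover the counts on the cycles are zero.\<close>
    let ?L' = "\<lambda>v. {v} \<times> {..<q}" and ?W' = "sum_cover_edges G q (\<lambda>e. 2 ^ b e)"
    have fold: "is_fold_cover q G ?L' \<lparr>verts = ?V \<times> {..<q}, edges = ?W'\<rparr>"
      by (rule sum_cover_is_fold_cover[OF G q0])
    have "dp_color_function G q \<le> card (unmatched_maps ?V ?L' ?W' ?E)"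
      using dp_color_function_le[OF fold] cover_count_eq_unmatched[OF G fold[unfolded is_fold_cover_def, THEN conjunct1]]
      by simp
    moreover have "matched_maps ?V ?L' ?W' (edges C) = {}" if "C \<in> cycles G ?r" for C
      using sum_cover_even_cycle[OF that _ b finE q] assms(1) by simp
    then have "(\<Sum>C\<in>cycles G ?r. int q ^ (n - g) - int (card (matched_maps ?V ?L' ?W' (edges C))))
        = int t * int q ^ (n - g)" using assms(7) by simp
    ultimately have "- (2 ^ m * int q ^ (n - g - 1))
        \<le> int (chromatic_polynomial G q) - int (dp_color_function G q) - int t * int q ^ (n - g)"
      using est[OF sum_cover_perfect[OF G q0, of "\<lambda>e. 2 ^ b e"]] by simp
    then show ?thesis using upper by linarith
  qed
  show ?thesis
  proof (rule bigoI[of _ "2 ^ m"], rule eventually_mono[OF eventually_gt_at_top])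
    fix q :: nat assume "(\<Sum>e\<in>?E. 2 ^ b e) < q"
    from bound[OF this] have "real_of_int \<bar>int (chromatic_polynomial G q) - int (dp_color_function G q) - int t * int q ^ (n - g)\<bar>
      \<le> real_of_int (2 ^ m * int q ^ (n - g - 1))" by (simp only: of_int_le_iff)
    then show "norm (real (chromatic_polynomial G q) - real (dp_color_function G q) - real t * real q ^ (n - g))
        \<le> 2 ^ m * norm (real q ^ (n - g - 1))" by simp
  qed
qed

end
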